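(* Let $\mathcal F=\{f_i:S\to S\}_{i=1}^\ell$ be an IFS on a compact set $S\subset\mathbb R^d$ such that: (i) $S$ is connected, $S=\overline{\mathrm{int}(S)}$ and $f_i(S)\subset\mathrm{int}(S)$ for all $i$; (ii) there is a bounded connected open set $U\supset S$ such that each $f_i$ extends to a $C^1$ conformal diffeomorphism $f_i:U\to f_i(U)\subset U$ with $\rho_i:=\sup_{x\in U}\|f_i'(x)\|<1$; (iii) $\max_{i\ne j}(\rho_i+\rho_j)<1$. Then there is $r_0>0$ such that the translational family $\mathcal F^{\mathfrak t}=\{f_i+\mathbf t_i\}_{i=1}^\ell$, $\mathfrak t=(\mathbf t_1,\dots,\mathbf t_\ell)\in\Delta:=\{\mathfrak s\in\mathbb R^{\ell d}:|\mathfrak s|<r_0\}$, satisfies the GTC with respect to Lebesgue measure $\mathcal L_{\ell d}$ on $\Delta$.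
   Context: Conformal: $f_i'(x)=D_xf_i$ is a nonzero scalar multiple of an orthogonal matrix for every $x\in U$. $\Sigma=\{1,\dots,\ell\}^{\mathbb N}$; for a word $\omega=\omega_1\cdots\omega_n$, $f^{\mathfrak t}_\omega=f^{\mathfrak t}_{\omega_1}\circ\cdots\circ f^{\mathfrak t}_{\omega_n}$ with $f^{\mathfrak t}_i=f_i+\mathbf t_i$; coding map $\Pi^{\mathfrak t}({\bf i})=\lim_nf^{\mathfrak t}_{{\bf i}|n}(z)$; ${\bf i}\wedge{\bf j}$ the longest common initial word of distinct ${\bf i},{\bf j}$ and $|{\bf i}\wedge{\bf j}|$ its length. Singular value function $\phi^k(T)=\alpha_1(T)\cdots\alpha_k(T)$ for integers $0\le k\le d$ (singular values decreasing). $Z^{\mathfrak t}_{\bf i}(r)=\inf_{x\in\Sigma}\min_{0\le k\le d}r^k/\phi^k(D_{\Pi^{\mathfrak t}x}f^{\mathfrak t}_{\bf i})$. GTC w.r.t. a measure $\eta$ on $\Delta$: there exist $\delta_0>0$ and $\psi:(0,\delta_0)\to[0,\infty)$ with $\psi(\delta)\to0$ as $\delta\to0$ such that for every $\mathfrak t_0\in\Delta$ and $0<\delta<\delta_0$ there is $C>0$ with $\eta\{\mathfrak t\in B(\mathfrak t_0,\delta)\cap\Delta:|\Pi^{\mathfrak t}({\bf i})-\Pi^{\mathfrak t}({\bf j})|<r\}\le Ce^{|{\bf i}\wedge{\bf j}|\psi(\delta)}Z^{\mathfrak t_0}_{{\bf i}\wedge{\bf j}}(r)$ for all distinct ${\bf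 i},{\bf j}\in\Sigma$ and $r>0$. *)

theory Defs
  imports "HOL-Analysis.Analysis"
begin

definition C1_on :: "'a::real_normed_vector set \<Rightarrow> ('a \<Rightarrow> 'b::real_normed_vector) \<Rightarrow> bool" where
  "C1_on A g \<longleftrightarrow> (\<exists>g'. (\<forall>x\<in>A. (g has_derivative blinfun_apply (g' x)) (at x)) \<and> continuous_on A g')"

definition conformal_linear :: "('a::real_inner \<Rightarrow> 'a) \<Rightarrow> bool" where
  "conformal_linear L \<longleftrightarrow> (\<exists>c Q. c \<noteq> 0 \<and> orthogonal_transformation Q \<and> L = (\<lambda>v. c *\<^sub>R Q v))"

fun word_comp :: "('i \<Rightarrow> 'a \<Rightarrow> 'a) \<Rightarrow> 'i list \<Rightarrow> 'a \<Rightarrow> 'a" where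
  "word_comp F [] = id"
| "word_comp F (a # w) = F a \<circ> word_comp F w"

definition restr :: "(nat \<Rightarrow> 'i) \<Rightarrow> nat \<Rightarrow> 'i list" where
  "restr \<omega> n = map \<omega> [0..<n]"

definition transl :: "('i::finite \<Rightarrow> 'a \<Rightarrow> 'a::real_normed_vector) \<Rightarrow> 'a ^ 'i \<Rightarrow> 'i \<Rightarrow> 'a \<Rightarrow> 'a" where
  "transl f t i x = f i x + t $ i"

definition coding :: "('i \<Rightarrow> 'a \<Rightarrow> 'a::real_normed_vector) \<Rightarrow> 'a \<Rightarrow> (nat \<Rightarrow> 'i) \<Rightarrow> 'a" where
  "coding F z \<omega> = lim (\<lambda>n. word_comp F (restr \<omega> n) z)"

definition cpl :: "(nat \<Rightarrow> 'i) \<Rightarrow> (nat \<Rightarrow> 'i) \<Rightarrow> nat" where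
  "cpl \<omega> \<tau> = (LEAST n. \<omega> n \<noteq> \<tau> n)"

text \<open>k-th singular value (k >= 1, decreasing order) of a linear map, via Courant-Fischer
  min-max: the max over k-dimensional subspaces V of min over unit vectors in V of |T v|.\<close>
definition singular_value :: "('a::euclidean_space \<Rightarrow> 'a) \<Rightarrow> nat \<Rightarrow> real" where
  "singular_value T k = Sup {Inf {norm (T v) | v. v \<in> V \<and> norm v = 1} | V. subspace V \<and> dim V = k}"

definition sv_fun :: "('a::euclidean_space \<Rightarrow> 'a) \<Rightarrow> nat \<Rightarrow> real" where
  "sv_fun T k = (\<Prod>j\<in>{1..k}. singular_value T j)"

definition Zfun :: "('i \<Rightarrow> 'a \<Rightarrow> 'a::euclidean_space) \<Rightarrow> 'a \<Rightarrow> 'i list \<Rightarrow> real \<Rightarrow> real" where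
  "Zfun F z \<omega> r = (INF x\<in>(UNIV :: (nat \<Rightarrow> 'i) set).
      Min ((\<lambda>k. r ^ k / sv_fun (frechet_derivative (word_comp F \<omega>) (at (coding F z x))) k)
           ` {0..DIM('a)}))"

definition GTC :: "('p::metric_space \<Rightarrow> 'i \<Rightarrow> 'a \<Rightarrow> 'a::euclidean_space) \<Rightarrow> 'a \<Rightarrow> 'p set \<Rightarrow> 'p measure \<Rightarrow> bool" where
  "GTC Ft z \<Delta> \<eta> \<longleftrightarrow>
    (\<exists>\<delta>0>0. \<exists>\<psi>::real \<Rightarrow> real.
      (\<forall>\<delta>\<in>{0<..<\<delta>0}. \<psi> \<delta> \<ge> 0) \<and> (\<psi> \<longlongrightarrow> 0) (at_right 0) \<and>
      (\<forall>t0\<in>\<Delta>. \<forall>\<delta>\<in>{0<..<\<delta>0}. \<exists>C>0. \<forall>\<omega> \<tau>::nat \<Rightarrow> 'i. \<omega> \<noteq> \<tau> \<longrightarrow> (\<forall>r>0.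
         {t \<in> ball t0 \<delta> \<inter> \<Delta>. dist (coding (Ft t) z \<omega>) (coding (Ft t) z \<tau>) < r} \<in> sets \<eta> \<and>
         emeasure \<eta> {t \<in> ball t0 \<delta> \<inter> \<Delta>. dist (coding (Ft t) z \<omega>) (coding (Ft t) z \<tau>) < r}
           \<le> ennreal (C * exp (real (cpl \<omega> \<tau>) * \<psi> \<delta>) * Zfun (Ft t0) z (restr \<omega> (cpl \<omega> \<tau>)) r))))"

end

theory Submission
  imports Defs
begin

text \<open>For conformal maps all singular values of the derivative of \<open>f\<^sub>u\<close> at \<open>x\<close> agree, so with \<open>\<alpha>\<close> their
  common value, \<open>Z\<close> is an infimum of \<open>min 1 ((s / \<alpha>) ^ d)\<close>. Let \<open>u\<close> be the common prefix of two codes. At small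
  scales each letter changes distances by almost exactly the factor given by its derivative, and
  after boundedly many letters all points involved are that close; hence the distance of the coded points for the
  parameter \<open>t\<close> is at least \<open>\<alpha>\<close> (computed for \<open>t\<^sub>0\<close>) times the distance of the points coded by the two tails, up to
  a factor \<open>C * exp (length u * \<psi> \<delta>)\<close>. The tails start with different letters \<open>i\<close> and \<open>j\<close>, and as \<open>t\<close> moves
  in the direction \<open>((1 - \<rho> i) v, - (1 - \<rho> j) v)\<close> in the coordinates \<open>i\<close> and \<open>j\<close>, their difference is expanding
  because \<open>\<rho> i + \<rho> j < 1\<close>. So the parameters for which the tails are \<open>s\<close>-close form a set that is thin in \<open>d\<close>
  directions, of measure \<open>O(s ^ d)\<close>.\<close>

section \<open>Singular values of conformal linear maps\<close>

text \<open>On unit vectors \<open>norm (T v)\<close> is constantly \<open>a\<close>, so every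
  competitor in the min-max formula has the value \<open>a\<close>. The lower bound on
  \<open>j\<close> supplies a unit vector in each \<open>V\<close>, the upper bound a subspace of
  dimension \<open>j\<close>.\<close>

lemma singular_value_conformal:
  fixes T :: "'a::euclidean_space \<Rightarrow> 'a"
  assumes T: "\<And>v. norm (T v) = a * norm v" and j: "1 \<le> j" "j \<le> DIM('a)"
  shows "singular_value T j = a"
proof -
  have "Inf {norm (T v) |v. v \<in> V \<and> norm v = 1} = a" if "subspace V" "dim V = j" for V :: "'a set"
  proof -
    have "\<not> V \<subseteq> {0}" using that j by (auto simp flip: dim_eq_0)
    then obtain w where w: "w \<in> V" "w \<noteq> 0" by blast
    have u: "(1 / norm w) *\<^sub>R w \<in> V \<and> norm ((1 / norm w) *\<^sub>R w) = 1"
      using w that by (simp add: subspace_mul)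
    have "{norm (T v) |v. v \<in> V \<and> norm v = 1} = (\<lambda>v. a) ` {v. v \<in> V \<and> norm v = 1}"
      unfolding setcompr_eq_image by (intro image_cong refl) (simp add: T)
    also have "\<dots> = {a}" using u by blast
    finally show ?thesis by simp
  qed
  then have "{Inf {norm (T v) |v. v \<in> V \<and> norm v = 1} |V. subspace V \<and> dim V = j}
      = (\<lambda>V. a) ` {V :: 'a set. subspace V \<and> dim V = j}"
    unfolding setcompr_eq_image[of "\<lambda>V. Inf {norm (T v) |v. v \<in> V \<and> norm v = 1}"]
    by (intro image_cong refl) blast
  also have "\<dots> = {a}"
    using choose_subspace_of_subspace[of j "UNIV :: 'a set"] j by auto
  finally show ?thesis by (simp only: singular_value_def cSup_singleton)
qed

lemma sv_fun_conformal:
  fixes T :: "'a::euclidean_space \<Rightarrow> 'a"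
  assumes "\<And>v. norm (T v) = a * norm v" and "k \<le> DIM('a)"
  shows "sv_fun T k = a ^ k"
  unfolding sv_fun_def using singular_value_conformal[OF assms(1)] assms(2) by simp

text \<open>The scalar of a conformal map is determined only up to sign; its absolute value is the
  operator norm, which therefore serves as the similarity ratio throughout.\<close>

lemma conformal_linear_norm:
  fixes L :: "'a::euclidean_space \<Rightarrow>\<^sub>L 'a"
  assumes "conformal_linear (blinfun_apply L)"
  shows "norm (blinfun_apply L v) = norm L * norm v" and "0 < norm L"
proof -
  obtain c Q where c: "c \<noteq> 0" "orthogonal_transformation Q" "blinfun_apply L = (\<lambda>v. c *\<^sub>R Q v)"
    using assms unfolding conformal_linear_def by blast
  have n: "norm (blinfun_apply L v) = \<bar>c\<bar> * norm v" for v
    using c by (simp add: orthogonal_transformation_norm)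
  have "\<bar>c\<bar> = norm L"
  proof (rule antisym)
    obtain b :: 'a where "b \<in> Basis" using nonempty_Basis by blast
    then show "\<bar>c\<bar> \<le> norm L" using norm_blinfun[of L b] by (simp add: n)
    show "norm L \<le> \<bar>c\<bar>" by (rule norm_blinfun_bound) (simp_all add: n)
  qed
  then show "norm (blinfun_apply L v) = norm L * norm v" "0 < norm L" using n c(1) by auto
qed

section \<open>Choosing a rate, and a bound for sets with thin slices\<close>

text \<open>Turns "every rate is admissible for small \<delta>" into one function of \<delta>. The
  infimum of the positive admissible rates need not be attained, so \<delta> is added to it; the
  uniformly admissible \<open>B\<close> keeps the set of rates nonempty for every \<delta>.\<close>

lemma exists_vanishing_rate:
  fixes Q :: "real \<Rightarrow> real \<Rightarrow> bool"
  assumes mono: "\<And>\<delta> \<eta> \<eta>'. Q \<delta> \<eta> \<Longrightarrow> \<eta> \<le> \<eta>' \<Longrightarrow> Q \<delta> \<eta>'"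
    and bounded: "\<And>\<delta>. Q \<delta> B" and "0 < B"
    and small: "\<And>\<eta>. 0 < \<eta> \<Longrightarrow> \<exists>\<theta>>0. \<forall>\<delta>. \<delta> < \<theta> \<longrightarrow> Q \<delta> \<eta>"
  shows "\<exists>\<psi>. (\<forall>\<delta>>0. 0 \<le> \<psi> \<delta> \<and> Q \<delta> (\<psi> \<delta>)) \<and> (\<psi> \<longlongrightarrow> 0) (at_right 0)"
proof -
  define A where "A \<delta> = {\<eta>. 0 < \<eta> \<and> Q \<delta> \<eta>}" for \<delta>
  define \<psi> where "\<psi> \<delta> = Inf (A \<delta>) + \<delta>" for \<delta>
  have ne: "A \<delta> \<noteq> {}" for \<delta> using bounded \<open>0 < B\<close> by (auto simp: A_def)
  have bdd: "bdd_below (A \<delta>)" for \<delta> by (rule bdd_belowI[of _ 0]) (auto simp: A_def)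
  have nonneg: "0 \<le> Inf (A \<delta>)" for \<delta>
    by (rule cInf_greatest[OF ne]) (auto simp: A_def)
  have "Q \<delta> (\<psi> \<delta>)" if "\<delta> > 0" for \<delta>
  proof -
    obtain \<eta> where "\<eta> \<in> A \<delta>" "\<eta> < \<psi> \<delta>"
      using cInf_lessD[OF ne, of \<delta> "\<psi> \<delta>"] \<open>\<delta> > 0\<close> by (force simp: \<psi>_def)
    then show ?thesis using mono by (auto simp: A_def)
  qed
  moreover have "0 \<le> \<psi> \<delta>" if "\<delta> > 0" for \<delta>
    using nonneg[of \<delta>] that by (simp add: \<psi>_def)
  moreover have "(\<psi> \<longlongrightarrow> 0) (at_right 0)"
  proof (rule tendstoI)
    fix e :: real assume e: "0 < e"
    then obtain \<theta> where \<theta>: "\<theta> > 0" "\<And>\<delta>. \<delta> < \<theta> \<Longrightarrow> Q \<delta> (e/2)"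
      using small[of "e/2"] by auto
    have "dist (\<psi> \<delta>) 0 < e" if "0 < \<delta>" "\<delta> < min \<theta> (e/2)" for \<delta>
    proof -
      have "Inf (A \<delta>) \<le> e/2"
        by (rule cInf_lower[OF _ bdd]) (use that e \<theta> in \<open>auto simp: A_def\<close>)
      then show ?thesis using nonneg[of \<delta>] that by (simp add: \<psi>_def)
    qed
    moreover have "0 < min \<theta> (e/2)" using \<theta> e by simp
    ultimately show "\<forall>\<^sub>F \<delta> in at_right 0. dist (\<psi> \<delta>) 0 < e"
      unfolding eventually_at_right_field by blast
  qed
  ultimately show ?thesis by blast
qed

text \<open>Replaces Fubini: if two points of \<open>E\<close> on the same translate of the range of \<open>c\<close> are
  less than \<open>D\<close> apart, then the translates of \<open>E\<close> along a grid of mesh \<open>D\<close> in that range are disjoint,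
  and about \<open>D\<close> to the power minus \<open>DIM('a)\<close> of them fit into a fixed ball.\<close>

lemma measure_thin_slices_le:
  fixes c :: "'a::euclidean_space \<Rightarrow> 'p::euclidean_space"
  assumes E: "E \<in> sets lebesgue" "E \<subseteq> ball 0 R"
    and c: "linear c" "\<And>v. norm (c v) \<le> M * norm v" and "0 \<le> M" and D: "0 < D"
    and thin: "\<And>p q v. p \<in> E \<Longrightarrow> q \<in> E \<Longrightarrow> p - q = c v \<Longrightarrow> norm v < D"
  shows "measure lebesgue E \<le> measure lebesgue (ball (0::'p) (R + M * DIM('a))) * D ^ DIM('a)"
proof -
  \<comment> \<open>The largest integer with \<open>m * D\<close> at most 1. If \<open>D\<close>
    exceeds 1 the grid is a single point, and \<open>m + 1\<close> is still at least
    \<open>1 / D\<close>.\<close>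
  define m where "m = nat \<lfloor>1 / D\<rfloor>"
  \<comment> \<open>Extensional functions, so that distinct elements differ at some basis
    vector.\<close>
  define G where "G = PiE (Basis::'a set) (\<lambda>_. {0..m})"
  define w :: "('a \<Rightarrow> nat) \<Rightarrow> 'a" where "w g = (\<Sum>b\<in>Basis. (D * real (g b)) *\<^sub>R b)" for g
  define T where "T g = (+) (c (w g)) ` E" for g
  have m: "real m \<le> 1 / D" "1 / D \<le> real m + 1"
    using D unfolding m_def using floor_correct[of "1 / D"] by auto
  have finG: "finite G" unfolding G_def by (intro finite_PiE) auto
  have cardG: "card G = (m + 1) ^ DIM('a)"
    unfolding G_def by (simp add: card_PiE)
  have w_inner: "w g \<bullet> b = D * real (g b)" if "b \<in> Basis" for g b
    unfolding w_def using that
    by (simp add: inner_sum_left inner_Basis if_distrib[where f="\<lambda>x. _ * x"] cong: if_cong)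
  have w_sep: "D \<le> norm (w g - w h)" if "g \<in> G" "h \<in> G" "g \<noteq> h" for g h
  proof -
    have "\<not> (\<forall>b\<in>Basis. g b = h b)"
    proof
      assume "\<forall>b\<in>Basis. g b = h b"
      then have "g = h" using that unfolding G_def by (intro PiE_ext) auto
      then show False using that by simp
    qed
    then obtain b where b: "b \<in> Basis" "g b \<noteq> h b" by blast
    have "D * 1 \<le> D * \<bar>real (g b) - real (h b)\<bar>"
      using b D by (intro mult_left_mono) auto
    also have "\<dots> = \<bar>(w g - w h) \<bullet> b\<bar>"
      unfolding inner_diff_left w_inner[OF b(1)] right_diff_distrib[symmetric] abs_mult using D by simp
    also have "\<dots> \<le> norm (w g - w h)" using b by (simp add: Basis_le_norm)
    finally show ?thesis by simp
  qed
  have w_norm: "norm (w g) \<le> DIM('a)" if "g \<in> G" for g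
  proof -
    have "norm (w g) \<le> (\<Sum>b\<in>(Basis::'a set). D * real (g b))"
      unfolding w_def by (rule order_trans[OF norm_sum]) (use D in simp)
    also have "\<dots> \<le> (\<Sum>b\<in>(Basis::'a set). 1)"
    proof (rule sum_mono)
      fix b :: 'a assume "b \<in> Basis"
      then have "g b \<le> m" using PiE_mem[of g Basis "\<lambda>_. {0..m}" b] that unfolding G_def by simp
      then have "real (g b) \<le> 1 / D" using m(1) by linarith
      then show "D * real (g b) \<le> 1" using D by (simp add: field_simps)
    qed
    finally show ?thesis by simp
  qed
  have Elm: "E \<in> lmeasurable"
    using bounded_set_imp_lmeasurable[OF bounded_subset[OF bounded_ball E(2)] E(1)] .
  have Tlm: "T g \<in> lmeasurable" for g unfolding T_def by (rule measurable_translation[OF Elm])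
  have disj: "disjoint_family_on T G"
  unfolding disjoint_family_on_def
  proof (intro ballI impI, rule ccontr)
    fix g h assume gh: "g \<in> G" "h \<in> G" "g \<noteq> h" and "T g \<inter> T h \<noteq> {}"
    then obtain p q where pq: "p \<in> E" "q \<in> E" "c (w g) + p = c (w h) + q"
      unfolding T_def by auto
    then have "p - q = c (w h) - c (w g)" by (simp add: algebra_simps)
    then have "p - q = c (w h - w g)" by (simp add: linear_diff[OF c(1)])
    then have "norm (w h - w g) < D" using thin pq by blast
    then show False using w_sep[of h g] gh by auto
  qed
  have sub: "T g \<subseteq> ball 0 (R + M * DIM('a))" if "g \<in> G" for g
  proof
    fix x assume "x \<in> T g"
    then obtain p where p: "p \<in> E" "x = c (w g) + p" unfolding T_def by auto
    have "norm x \<le> norm (c (w g)) + norm p" using p norm_triangle_ineq by simp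
    also have "norm p < R" using p E(2) by auto
    also have "norm (c (w g)) \<le> M * DIM('a)"
      using c(2)[of "w g"] mult_left_mono[OF w_norm[OF that] \<open>0 \<le> M\<close>] by linarith
    finally show "x \<in> ball 0 (R + M * DIM('a))" by simp
  qed
  have "(1 / D) ^ DIM('a) * measure lebesgue E \<le> real (card G) * measure lebesgue E"
    unfolding cardG of_nat_power using m D
    by (intro mult_right_mono power_mono) auto
  also have "\<dots> = (\<Sum>g\<in>G. measure lebesgue (T g))"
    by (simp add: T_def measure_translation)
  also have "\<dots> = measure lebesgue (\<Union>g\<in>G. T g)"
    using fmeasurableD[OF Tlm] fmeasurableD2[OF Tlm]
    by (intro measure_finite_Union[symmetric] finG disj) auto
  also have "\<dots> \<le> measure lebesgue (ball (0::'p) (R + M * DIM('a)))"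
    using sub Tlm finG by (intro measure_mono_fmeasurable) (auto intro!: fmeasurable.finite_UN)
  finally show ?thesis using D by (simp add: field_simps)
qed

lemma min_one_mult_le:
  fixes c x :: real
  assumes "1 \<le> c" "0 \<le> x"
  shows "min 1 (c * x) \<le> c * min 1 x"
proof -
  have "min 1 (c * x) \<le> min c (c * x)" using assms by (intro min.mono) auto
  then show ?thesis using assms by (simp add: min_mult_distrib_left)
qed

section \<open>Words, and contraction of the word maps on \<open>S\<close>\<close>

lemma word_comp_restr_Suc:
  "word_comp F (restr \<omega> (Suc n)) = F (\<omega> 0) \<circ> word_comp F (restr (\<lambda>m. \<omega> (Suc m)) n)"
  unfolding restr_def by (simp add: map_upt_Suc del: upt_Suc)

lemma word_comp_append: "word_comp F (u @ v) = word_comp F u \<circ> word_comp F v"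
  by (induction u) auto

lemma restr_add: "restr \<omega> (n + k) = restr \<omega> n @ restr (\<lambda>m. \<omega> (n + m)) k"
  by (rule nth_equalityI) (auto simp: restr_def nth_append)

lemma length_restr [simp]: "length (restr \<omega> n) = n"
  by (simp add: restr_def)

text \<open>The derivative bound makes \<open>f i\<close> contract only along segments inside \<open>U\<close>, so \<open>f i\<close> is
  \<open>\<rho> i\<close>-Lipschitz merely at distances up to the collar width \<open>\<epsilon>\<close>.\<close>

locale translated_conformal_ifs =
  fixes f :: "'l::finite \<Rightarrow> 'a::euclidean_space \<Rightarrow> 'a"
    and f' :: "'l \<Rightarrow> 'a \<Rightarrow> 'a \<Rightarrow>\<^sub>L 'a"
    and S U :: "'a set" and \<rho> :: "'l \<Rightarrow> real" and z :: 'a and \<epsilon> r0 r :: real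
  assumes compact_S: "compact S" and connected_S: "connected S" and z_in_S: "z \<in> S"
    and eps_pos: "0 < \<epsilon>" and collar: "\<And>x. x \<in> S \<Longrightarrow> cball x \<epsilon> \<subseteq> U"
    and deriv: "\<And>i x. x \<in> U \<Longrightarrow> (f i has_derivative blinfun_apply (f' i x)) (at x)"
    and cont_deriv: "\<And>i. continuous_on U (f' i)"
    and inj: "\<And>i. inj_on (f i) U"
    and conformal: "\<And>i x. x \<in> U \<Longrightarrow> conformal_linear (blinfun_apply (f' i x))"
    and deriv_le: "\<And>i x. x \<in> U \<Longrightarrow> norm (f' i x) \<le> \<rho> i"
    and rho_le: "\<And>i. \<rho> i \<le> r" and r_less_1: "r < 1"
    and rho_pair: "\<And>i j. i \<noteq> j \<Longrightarrow> \<rho> i + \<rho> j < 1"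
    and r0_pos: "0 < r0"
    and stable: "\<And>i x v. x \<in> S \<Longrightarrow> norm v < r0 \<Longrightarrow> f i x + v \<in> S"
begin

abbreviation "W t \<equiv> word_comp (transl f t)"
abbreviation "P t \<equiv> coding (transl f t) z"

lemma S_subset_U: "x \<in> S \<Longrightarrow> x \<in> U"
  using collar[of x] eps_pos by auto

lemma deriv_pos: "x \<in> U \<Longrightarrow> 0 < norm (f' i x)"
  using conformal_linear_norm(2)[OF conformal] by blast

lemma rho_pos: "0 < \<rho> i"
  using deriv_pos[OF S_subset_U[OF z_in_S]] deriv_le[OF S_subset_U[OF z_in_S]] by (rule less_le_trans)

lemma r_pos: "0 < r"
  using rho_pos rho_le by (rule less_le_trans)

lemma f_dist_le:
  assumes "x \<in> S" "dist x y \<le> \<epsilon>"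
  shows "dist (f i x) (f i y) \<le> \<rho> i * dist x y"
proof -
  have "norm (f i x - f i y) \<le> \<rho> i * norm (x - y)"
  proof (rule differentiable_bound[of "cball x \<epsilon>" _ "\<lambda>x. blinfun_apply (f' i x)"])
    fix \<xi> assume "\<xi> \<in> cball x \<epsilon>"
    then have "\<xi> \<in> U" using collar assms by blast
    then show "(f i has_derivative blinfun_apply (f' i \<xi>)) (at \<xi> within cball x \<epsilon>)"
      and "onorm (blinfun_apply (f' i \<xi>)) \<le> \<rho> i"
      using deriv deriv_le by (auto intro: has_derivative_at_withinI simp: norm_blinfun.rep_eq)
  qed (use assms eps_pos in auto)
  then show ?thesis by (simp add: dist_norm)
qed

lemma norm_nth_less: "norm (t :: 'a ^ 'l) < r0 \<Longrightarrow> norm (t $ i) < r0"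
  using Finite_Cartesian_Product.norm_nth_le[of t i] by linarith

lemma dist_transl [simp]: "dist (transl f t i x) (transl f t i y) = dist (f i x) (f i y)"
  by (simp add: transl_def)

lemma W_in_S:
  assumes "norm t < r0" "x \<in> S"
  shows "W t u x \<in> S"
proof (induction u)
  case (Cons a u)
  then show ?case using stable[OF Cons norm_nth_less[OF assms(1)]] by (simp add: transl_def)
qed (use assms in simp)

text \<open>Letters are added on the outside. The distance never grows, so it stays within
  \<epsilon> and the local Lipschitz bound applies again; only the image of \<open>x\<close> has to
  remain in \<open>S\<close>.\<close>

lemma W_dist_le_near:
  assumes "norm t < r0" "x \<in> S" "dist x y \<le> \<epsilon>"
  shows "dist (W t u x) (W t u y) \<le> r ^ length u * dist x y"
proof (induction u)
  case (Cons a u)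
  have "r ^ length u * dist x y \<le> 1 * dist x y"
    using r_pos r_less_1 by (intro mult_right_mono) (auto simp: power_le_one)
  then have "dist (W t u x) (W t u y) \<le> \<epsilon>" using Cons assms(3) by linarith
  then have "dist (W t (a # u) x) (W t (a # u) y) \<le> \<rho> a * dist (W t u x) (W t u y)"
    using f_dist_le[OF W_in_S] assms by simp
  also have "\<dots> \<le> r * (r ^ length u * dist x y)"
    using Cons rho_le r_pos by (intro mult_mono) auto
  finally show ?case by simp
qed simp

text \<open>\<open>S\<close> need not be convex, so two of its points are compared through a finite chain with steps below
  \<open>\<epsilon>\<close>, the length of which is bounded uniformly.\<close>

lemma W_dist_le:
  "\<exists>K>0. \<forall>t u x y. norm t < r0 \<longrightarrow> x \<in> S \<longrightarrow> y \<in> S \<longrightarrow> dist (W t u x) (W t u y) \<le> K * r ^ length u"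
proof -
  \<comment> \<open>\<open>K\<close> may depend on the two points but not on the parameter or the
    word. By the bound at distance \<epsilon> the related points contain a neighbourhood of each
    point of \<open>S\<close>, so connectedness relates all of \<open>S\<close> to
    \<open>z\<close>.\<close>
  define R where "R x y \<longleftrightarrow> (\<exists>K. \<forall>t u. norm t < r0 \<longrightarrow> dist (W t u x) (W t u y) \<le> K * r ^ length u)"
    for x y
  have R: "R z x" if "x \<in> S" for x
  proof (rule connected_equivalence_relation[OF connected_S z_in_S that])
    show "R y x" if "R x y" for x y using that by (simp add: R_def dist_commute)
    show "R x w" if xy: "R x y" and yw: "R y w" for x y w
    proof -
      obtain K where K: "\<And>t u. norm t < r0 \<Longrightarrow> dist (W t u x) (W t u y) \<le> K * r ^ length u"
        using xy unfolding R_def by blast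
      obtain L where L: "\<And>t u. norm t < r0 \<Longrightarrow> dist (W t u y) (W t u w) \<le> L * r ^ length u"
        using yw unfolding R_def by blast
      have "dist (W t u x) (W t u w) \<le> (K + L) * r ^ length u" if "norm t < r0" for t u
        using K[OF that, of u] L[OF that, of u] dist_triangle[of "W t u x" "W t u w" "W t u y"]
        by (simp add: distrib_right)
      then show ?thesis unfolding R_def by blast
    qed
    show "\<exists>T. openin (top_of_set S) T \<and> a \<in> T \<and> (\<forall>x\<in>T. R a x)" if "a \<in> S" for a
    proof (intro exI conjI ballI)
      show "openin (top_of_set S) (S \<inter> ball a \<epsilon>)" by (simp add: openin_open_Int)
      show "a \<in> S \<inter> ball a \<epsilon>" using that eps_pos by simp
      fix x assume "x \<in> S \<inter> ball a \<epsilon>"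
      then show "R a x" unfolding R_def using W_dist_le_near[OF _ \<open>a \<in> S\<close>, of _ x]
        by (intro exI[of _ "dist a x"]) (auto simp: mult.commute)
    qed
  qed
  obtain A where A: "A \<subseteq> S" "finite A" "S \<subseteq> (\<Union>p\<in>A. ball p \<epsilon>)"
    using compactE_image[OF compact_S, of S "\<lambda>p. ball p \<epsilon>"] eps_pos by (metis UN_I centre_in_ball open_ball subsetI)
  from R A have "\<forall>p\<in>A. \<exists>K. \<forall>t u. norm t < r0 \<longrightarrow> dist (W t u z) (W t u p) \<le> K * r ^ length u"
    unfolding R_def by blast
  then obtain k where k: "\<And>p t u. p \<in> A \<Longrightarrow> norm t < r0 \<Longrightarrow> dist (W t u z) (W t u p) \<le> k p * r ^ length u"
    by metis
  \<comment> \<open>Makes the constant independent of the point: \<open>\<bar>k p\<bar>\<close> pays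
    for the way from \<open>z\<close> to a centre \<open>p\<close> of the finite cover, \<epsilon>
    for the last step from \<open>p\<close> to \<open>x\<close>. The sum dominates each single
    term.\<close>
  define M where "M = \<epsilon> + (\<Sum>p\<in>A. \<bar>k p\<bar>)"
  have M: "dist (W t u z) (W t u x) \<le> M * r ^ length u" if t: "norm t < r0" and x: "x \<in> S" for t u x
  proof -
    obtain p where p: "p \<in> A" "dist p x < \<epsilon>" using A x by auto
    have "k p \<le> \<bar>k p\<bar>" by simp
    also have "\<dots> \<le> (\<Sum>p\<in>A. \<bar>k p\<bar>)" using p A(2) by (intro member_le_sum) auto
    finally have "k p * r ^ length u \<le> (\<Sum>p\<in>A. \<bar>k p\<bar>) * r ^ length u"
      using r_pos by (intro mult_right_mono) auto
    moreover have "dist (W t u p) (W t u x) \<le> r ^ length u * dist p x"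
      using p A t by (intro W_dist_le_near) auto
    moreover have "r ^ length u * dist p x \<le> r ^ length u * \<epsilon>"
      using p r_pos by (intro mult_left_mono) auto
    ultimately show ?thesis
      using k[OF p(1) t, of u] dist_triangle[of "W t u z" "W t u x" "W t u p"]
      unfolding M_def by (simp add: algebra_simps)
  qed
  have "0 \<le> (\<Sum>p\<in>A. \<bar>k p\<bar>)" by (rule sum_nonneg) simp
  then have "0 < 2 * M" unfolding M_def using eps_pos by (simp add: add_pos_nonneg)
  moreover have "dist (W t u x) (W t u y) \<le> 2 * M * r ^ length u"
    if "norm t < r0" "x \<in> S" "y \<in> S" for t u x y
    using M[OF that(1,2), of u] M[OF that(1,3), of u] dist_triangle3[of "W t u x" "W t u y" "W t u z"]
    by simp
  ultimately show ?thesis by blast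
qed

section \<open>Dependence on the parameter, and the coding map\<close>

text \<open>\<open>a\<close> is the fixed point of the estimate for one letter,
  \<open>\<rho> k * a + (1 - \<rho> k) * a = a\<close>, so the error does not accumulate with the
  length of the word. The bound is imposed per coordinate because the weights used in the
  transversality argument depend on the coordinate.\<close>

lemma W_dist_param_le:
  assumes "norm t < r0" "norm t' < r0" "x \<in> S" "a \<le> \<epsilon>" "0 \<le> a"
    and "\<And>k. norm (t $ k - t' $ k) \<le> (1 - \<rho> k) * a"
  shows "dist (W t u x) (W t' u x) \<le> a"
proof (induction u)
  case (Cons k u)
  have "dist (f k (W t u x)) (f k (W t' u x)) \<le> \<rho> k * dist (W t u x) (W t' u x)"
    using Cons assms by (intro f_dist_le W_in_S) auto
  also have "\<dots> \<le> \<rho> k * a" using Cons rho_pos[of k] by (intro mult_left_mono) auto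
  finally have "dist (f k (W t u x)) (f k (W t' u x)) \<le> \<rho> k * a" .
  moreover have "dist (W t (k # u) x) (W t' (k # u) x)
      \<le> dist (f k (W t u x)) (f k (W t' u x)) + norm (t $ k - t' $ k)"
    unfolding dist_norm word_comp.simps transl_def o_def
    by (rule order_trans[OF _ norm_triangle_ineq]) (simp add: algebra_simps)
  ultimately show ?case using assms(6)[of k] by (simp add: algebra_simps)
qed (use assms in simp)

lemma norm_diff_nth_le: "norm ((t :: 'a ^ 'l) $ k - t' $ k) \<le> (1 - \<rho> k) * (dist t t' / (1 - r))"
proof -
  have "norm (t $ k - t' $ k) \<le> dist t t'"
    using Finite_Cartesian_Product.norm_nth_le[of "t - t'" k] by (simp add: dist_norm)
  also have "\<dots> = (1 - r) * (dist t t' / (1 - r))" using r_less_1 by simp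
  also have "\<dots> \<le> (1 - \<rho> k) * (dist t t' / (1 - r))"
    using r_less_1 rho_le[of k] by (intro mult_right_mono) auto
  finally show ?thesis .
qed

text \<open>\<open>coding\<close> is a \<open>lim\<close>, which is informative only once
  convergence is known. Lengthening the code only changes the inner point within \<open>S\<close>,
  so \<open>W_dist_le\<close> makes the sequence Cauchy.\<close>

lemma P_lim:
  assumes t: "norm t < r0"
  shows "(\<lambda>n. W t (restr \<omega> n) z) \<longlonglongrightarrow> P t \<omega>"
proof -
  obtain K where K: "K > 0" "\<And>t u x y. norm t < r0 \<Longrightarrow> x \<in> S \<Longrightarrow> y \<in> S \<Longrightarrow>
      dist (W t u x) (W t u y) \<le> K * r ^ length u"
    using W_dist_le by blast
  have "Cauchy (\<lambda>n. W t (restr \<omega> n) z)"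
  proof (rule metric_CauchyI)
    fix e :: real assume "0 < e"
    have "(\<lambda>n. K * r ^ n) \<longlonglongrightarrow> K * 0"
      using r_pos r_less_1 by (intro tendsto_mult_left LIMSEQ_power_zero) auto
    then have "\<forall>\<^sub>F n in sequentially. K * r ^ n < e / 2" by (rule order_tendstoD) (use \<open>0 < e\<close> in simp)
    then obtain M where M: "K * r ^ M < e / 2" by (auto simp: eventually_sequentially)
    have "dist (W t (restr \<omega> M) z) (W t (restr \<omega> n) z) < e / 2" if "n \<ge> M" for n
    proof -
      have "restr \<omega> n = restr \<omega> M @ restr (\<lambda>m. \<omega> (M + m)) (n - M)"
        using restr_add[of \<omega> M "n - M"] that by simp
      then show ?thesis
        using K(2)[OF t z_in_S W_in_S[OF t z_in_S], of "restr \<omega> M" "restr (\<lambda>m. \<omega> (M + m)) (n - M)"] M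
        by (simp add: word_comp_append)
    qed
    then show "\<exists>M. \<forall>m\<ge>M. \<forall>n\<ge>M. dist (W t (restr \<omega> m) z) (W t (restr \<omega> n) z) < e"
      by (meson dist_triangle_half_r)
  qed
  then show ?thesis
    unfolding coding_def by (simp add: Cauchy_convergent convergent_LIMSEQ_iff[symmetric])
qed

lemma P_in_S: "norm t < r0 \<Longrightarrow> P t \<omega> \<in> S"
  using closed_sequentially[OF compact_imp_closed[OF compact_S] _ P_lim] W_in_S z_in_S by blast

lemma P_Suc:
  assumes t: "norm t < r0"
  shows "P t \<omega> = transl f t (\<omega> 0) (P t (\<lambda>m. \<omega> (Suc m)))"
proof (rule LIMSEQ_unique)
  show "(\<lambda>n. W t (restr \<omega> (Suc n)) z) \<longlonglongrightarrow> P t \<omega>"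
    using P_lim[OF t] by (rule LIMSEQ_Suc)
  have "isCont (f (\<omega> 0)) (P t (\<lambda>m. \<omega> (Suc m)))"
    using has_derivative_continuous[OF deriv] S_subset_U P_in_S[OF t] by blast
  then have "(\<lambda>n. f (\<omega> 0) (W t (restr (\<lambda>m. \<omega> (Suc m)) n) z)) \<longlonglongrightarrow> f (\<omega> 0) (P t (\<lambda>m. \<omega> (Suc m)))"
    using isCont_tendsto_compose P_lim[OF t] by blast
  then show "(\<lambda>n. W t (restr \<omega> (Suc n)) z) \<longlonglongrightarrow> transl f t (\<omega> 0) (P t (\<lambda>m. \<omega> (Suc m)))"
    unfolding word_comp_restr_Suc o_def transl_def by (intro tendsto_intros)
qed

lemma P_add:
  assumes t: "norm t < r0"
  shows "P t \<omega> = W t (restr \<omega> n) (P t (\<lambda>m. \<omega> (n + m)))"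
proof (induction n arbitrary: \<omega>)
  case (Suc n)
  show ?case using P_Suc[OF t, of \<omega>] Suc[of "\<lambda>m. \<omega> (Suc m)"] by (simp add: word_comp_restr_Suc)
qed (simp add: restr_def)

lemma P_dist_param_le:
  assumes "norm t < r0" "norm t' < r0" "a \<le> \<epsilon>" "0 \<le> a"
    and "\<And>k. norm (t $ k - t' $ k) \<le> (1 - \<rho> k) * a"
  shows "dist (P t \<omega>) (P t' \<omega>) \<le> a"
  by (rule LIMSEQ_le_const2[OF tendsto_dist[OF P_lim P_lim]])
    (use assms W_dist_param_le z_in_S in blast)+

text \<open>Makes the sets of parameters in \<open>GTC\<close> open, hence measurable.\<close>

lemma continuous_on_P: "continuous_on (ball 0 r0) (\<lambda>t. P t \<omega>)"
  unfolding continuous_on_iff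
proof (intro ballI allI impI)
  fix t :: "'a ^ 'l" and e :: real assume t: "t \<in> ball 0 r0" and e: "0 < e"
  show "\<exists>d>0. \<forall>t'\<in>ball 0 r0. dist t' t < d \<longrightarrow> dist (P t' \<omega>) (P t \<omega>) < e"
  proof (intro exI[of _ "(1 - r) * min \<epsilon> e"] conjI ballI impI)
    show "0 < (1 - r) * min \<epsilon> e" using r_less_1 eps_pos e by simp
    fix t' assume t': "t' \<in> ball 0 r0" "dist t' t < (1 - r) * min \<epsilon> e"
    then have "dist t' t / (1 - r) < min \<epsilon> e"
      using r_less_1 by (subst pos_divide_less_eq) (auto simp: mult.commute)
    moreover have "dist (P t' \<omega>) (P t \<omega>) \<le> dist t' t / (1 - r)"
      using t t' r_less_1 calculation norm_diff_nth_le by (intro P_dist_param_le) auto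
    ultimately show "dist (P t' \<omega>) (P t \<omega>) < e" by simp
  qed
qed

section \<open>Parameters at which two coded points are close\<close>

lemma open_P_close: "open {t \<in> ball t0 \<delta> \<inter> ball 0 r0. dist (P t \<omega>) (P t \<tau>) < s}"
proof -
  have "open ((ball t0 \<delta> \<inter> ball 0 r0) \<inter> (\<lambda>t. dist (P t \<omega>) (P t \<tau>)) -` {..<s})"
    by (intro continuous_open_preimage continuous_on_dist continuous_on_subset[OF continuous_on_P]) auto
  moreover have "(ball t0 \<delta> \<inter> ball 0 r0) \<inter> (\<lambda>t. dist (P t \<omega>) (P t \<tau>)) -` {..<s}
      = {t \<in> ball t0 \<delta> \<inter> ball 0 r0. dist (P t \<omega>) (P t \<tau>) < s}" by auto
  ultimately show ?thesis by simp
qed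

text \<open>Moving the parameter along \<open>slide i j\<close> changes every coded point by at most \<open>norm v\<close>: the
  weight \<open>1 - \<rho> i\<close> solves \<open>\<rho> i * a + weight * norm v = a\<close> at \<open>a = norm v\<close>. With opposite signs at
  \<open>i\<close> and \<open>j\<close>, the translations themselves separate the two points by \<open>(2 - \<rho> i - \<rho> j) * norm v\<close>, which
  dominates the total induced motion \<open>(\<rho> i + \<rho> j) * norm v\<close> exactly when \<open>\<rho> i + \<rho> j < 1\<close>.\<close>

definition slide :: "'l \<Rightarrow> 'l \<Rightarrow> 'a \<Rightarrow> 'a ^ 'l" where
  "slide i j v = (\<chi> k. if k = i then (1 - \<rho> i) *\<^sub>R v else if k = j then - ((1 - \<rho> j) *\<^sub>R v) else 0)"

lemma rho_less_1: "\<rho> i < 1"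
  using rho_le[of i] r_less_1 by linarith

lemma norm_slide_nth_le: "norm (slide i j v $ k) \<le> (1 - \<rho> k) * norm v"
  using rho_less_1[of i] rho_less_1[of j] rho_less_1[of k] by (auto simp: slide_def)

lemma linear_slide: "linear (slide i j)"
  by (rule linearI) (auto simp: slide_def vec_eq_iff algebra_simps)

lemma norm_slide_le: "norm (slide i j v) \<le> 2 * norm v"
proof -
  have "norm (slide i j v) \<le> (\<Sum>k\<in>UNIV. norm (slide i j v $ k))"
    unfolding norm_vec_def by (rule L2_set_le_sum) simp
  also have "\<dots> \<le> (\<Sum>k\<in>UNIV. (if k = i then norm v else 0) + (if k = j then norm v else 0))"
  proof (rule sum_mono)
    fix k
    have "(1 - \<rho> k) * norm v \<le> 1 * norm v"
      using rho_pos[of k] by (intro mult_right_mono) auto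
    then have "norm (slide i j v $ k) \<le> norm v" using norm_slide_nth_le[of i j v k] by simp
    then show "norm (slide i j v $ k) \<le> (if k = i then norm v else 0) + (if k = j then norm v else 0)"
      by (cases "k = i \<or> k = j") (auto simp: slide_def intro: order_trans)
  qed
  also have "\<dots> = 2 * norm v" by (simp add: sum.distrib)
  finally show ?thesis .
qed

lemma transversality:
  assumes t: "norm t < r0" "norm t' < r0" and v: "t - t' = slide (\<omega> 0) (\<tau> 0) v" "norm v \<le> \<epsilon>"
    and ne: "\<omega> 0 \<noteq> \<tau> 0"
  shows "2 * (1 - \<rho> (\<omega> 0) - \<rho> (\<tau> 0)) * norm v \<le> norm ((P t \<omega> - P t \<tau>) - (P t' \<omega> - P t' \<tau>))"
proof -
  define i j where "i = \<omega> 0" and "j = \<tau> 0"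
  define \<omega>' \<tau>' where "\<omega>' = (\<lambda>m. \<omega> (Suc m))" and "\<tau>' = (\<lambda>m. \<tau> (Suc m))"
  define A where "A = f i (P t \<omega>') - f i (P t' \<omega>')"
  define B where "B = f j (P t \<tau>') - f j (P t' \<tau>')"
  have k: "norm (t $ k - t' $ k) \<le> (1 - \<rho> k) * norm v" for k
    using norm_slide_nth_le[of i j v k] v(1) by (simp add: i_def j_def flip: vector_minus_component)
  have P: "dist (P t \<sigma>) (P t' \<sigma>) \<le> norm v" for \<sigma>
    using t v(2) k by (intro P_dist_param_le) auto
  have f: "norm (f l (P t \<sigma>) - f l (P t' \<sigma>)) \<le> \<rho> l * norm v" for l \<sigma>
  proof -
    have "dist (f l (P t \<sigma>)) (f l (P t' \<sigma>)) \<le> \<rho> l * dist (P t \<sigma>) (P t' \<sigma>)"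
      using P[of \<sigma>] v(2) t by (intro f_dist_le P_in_S) auto
    also have "\<dots> \<le> \<rho> l * norm v" using P[of \<sigma>] rho_pos[of l] by (intro mult_left_mono) auto
    finally show ?thesis by (simp add: dist_norm)
  qed
  have i: "t $ i - t' $ i = (1 - \<rho> i) *\<^sub>R v" and j: "t $ j - t' $ j = - ((1 - \<rho> j) *\<^sub>R v)"
    using v(1) ne by (simp_all add: i_def j_def slide_def flip: vector_minus_component)
  \<comment> \<open>Peeling off one letter exposes the coordinates \<open>i\<close> and
    \<open>j\<close> of the parameter. These contribute
    \<open>(2 - \<rho> i - \<rho> j) *\<^sub>R v\<close>, while \<open>A - B\<close> is the induced
    motion of the tails.\<close>
  have "(P t \<omega> - P t \<tau>) - (P t' \<omega> - P t' \<tau>) = A - B + ((t $ i - t' $ i) - (t $ j - t' $ j))"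
    using P_Suc[OF t(1), of \<omega>] P_Suc[OF t(1), of \<tau>] P_Suc[OF t(2), of \<omega>] P_Suc[OF t(2), of \<tau>]
    unfolding A_def B_def \<omega>'_def \<tau>'_def i_def j_def transl_def by (simp add: algebra_simps)
  also have "\<dots> = (A - B) - (-(2 - \<rho> i - \<rho> j)) *\<^sub>R v"
    unfolding i j by (simp add: algebra_simps scaleR_2)
  finally have eq: "(P t \<omega> - P t \<tau>) - (P t' \<omega> - P t' \<tau>) = (A - B) - (-(2 - \<rho> i - \<rho> j)) *\<^sub>R v" .
  have "norm (A - B) \<le> (\<rho> i + \<rho> j) * norm v"
    using f[of i \<omega>'] f[of j \<tau>'] norm_triangle_ineq4[of A B] unfolding A_def B_def
    by (simp add: algebra_simps)
  moreover have "norm ((-(2 - \<rho> i - \<rho> j)) *\<^sub>R v) = (2 - \<rho> i - \<rho> j) * norm v"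
    using rho_less_1[of i] rho_less_1[of j] by simp
  ultimately have "(2 - \<rho> i - \<rho> j) * norm v - (\<rho> i + \<rho> j) * norm v
      \<le> norm ((P t \<omega> - P t \<tau>) - (P t' \<omega> - P t' \<tau>))"
    unfolding eq using norm_triangle_ineq2[of "(-(2 - \<rho> i - \<rho> j)) *\<^sub>R v" "A - B"]
      norm_minus_commute[of "A - B" "(-(2 - \<rho> i - \<rho> j)) *\<^sub>R v"]
    by linarith
  then show ?thesis unfolding i_def j_def by (simp add: algebra_simps)
qed

text \<open>The slice estimate for \<open>slide\<close> with mesh \<open>2 * s / \<kappa>\<close>:
  by transversality, two parameters on one slice that both keep the coded points
  \<open>s\<close>-close are less than this apart. For large \<open>s\<close> the volume
  \<open>V\<close> of a fixed ball is the bound. The restriction on \<delta> keeps differences along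
  a slice within \<epsilon>.\<close>

lemma measure_P_close_le:
  "\<exists>C>0. \<forall>t0 \<delta> \<omega> \<tau> s. 0 < s \<longrightarrow> 0 < \<delta> \<longrightarrow> \<delta> \<le> \<epsilon> * (1 - r) / 2 \<longrightarrow> \<omega> 0 \<noteq> \<tau> 0 \<longrightarrow>
     measure lebesgue {t \<in> ball t0 \<delta> \<inter> ball 0 r0. dist (P t \<omega>) (P t \<tau>) < s} \<le> C * min 1 (s ^ DIM('a))"
proof -
  \<comment> \<open>A separation constant uniform over the finitely many pairs; diagonal pairs get
    the harmless value 1.\<close>
  define \<kappa> where "\<kappa> = Min ((\<lambda>(i, j). if i = j then 1 else 2 * (1 - \<rho> i - \<rho> j)) ` UNIV)"
  have "0 < (if i = j then 1 else 2 * (1 - \<rho> i - \<rho> j))" for i j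
    using rho_pair[of i j] by auto
  then have \<kappa>: "0 < \<kappa>"
    unfolding \<kappa>_def by (subst Min_gr_iff) (auto simp del: zero_less_mult_iff)
  have \<kappa>_le: "\<kappa> \<le> 2 * (1 - \<rho> i - \<rho> j)" if "i \<noteq> j" for i j
    unfolding \<kappa>_def by (rule Min_le) (use that in \<open>auto intro!: image_eqI[of _ _ "(i, j)"]\<close>)
  define V where "V = measure lebesgue (ball (0 :: 'a ^ 'l) (r0 + 2 * real DIM('a)))"
  define C where "C = V * max 1 ((2 / \<kappa>) ^ DIM('a)) + 1"
  have V: "0 \<le> V" by (simp add: V_def)
  have "measure lebesgue {t \<in> ball t0 \<delta> \<inter> ball 0 r0. dist (P t \<omega>) (P t \<tau>) < s} \<le> C * min 1 (s ^ DIM('a))"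
    if s: "0 < s" and \<delta>: "0 < \<delta>" "\<delta> \<le> \<epsilon> * (1 - r) / 2" and ne: "\<omega> 0 \<noteq> \<tau> 0" for t0 \<delta> \<omega> \<tau> s
  proof -
    define E where "E = {t \<in> ball t0 \<delta> \<inter> ball 0 r0. dist (P t \<omega>) (P t \<tau>) < s}"
    have E: "E \<in> sets lebesgue" "E \<subseteq> ball 0 r0" "bounded E"
      using open_P_close by (auto simp: E_def intro: bounded_subset[OF bounded_ball, of _ 0 r0])
    have "measure lebesgue E \<le> V * (2 * s / \<kappa>) ^ DIM('a)"
      unfolding V_def
    proof (rule measure_thin_slices_le[OF E(1,2) linear_slide[of "\<omega> 0" "\<tau> 0"] norm_slide_le])
      show "0 < 2 * s / \<kappa>" using s \<kappa> by simp
      fix p q v assume pq: "p \<in> E" "q \<in> E" "p - q = slide (\<omega> 0) (\<tau> 0) v"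
      \<comment> \<open>The coordinate \<open>\<omega> 0\<close> of the slide recovers
        \<open>norm v\<close> from the distance of the parameters, which is below
        \<open>2 * \<delta>\<close>.\<close>
      have "(1 - r) * norm v \<le> (1 - \<rho> (\<omega> 0)) * norm v"
        using rho_le by (intro mult_right_mono) auto
      also have "\<dots> = norm ((p - q) $ \<omega> 0)"
        unfolding pq(3) using rho_less_1[of "\<omega> 0"] by (simp add: slide_def)
      also have "\<dots> \<le> norm (p - q)" by (rule Finite_Cartesian_Product.norm_nth_le)
      also have "\<dots> \<le> 2 * \<delta>"
        using pq dist_triangle3[of p q t0] unfolding E_def by (simp add: dist_norm)
      also have "\<dots> \<le> (1 - r) * \<epsilon>" using \<delta> by (simp add: algebra_simps)
      finally have v: "norm v \<le> \<epsilon>" using r_less_1 by simp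
      have "\<kappa> * norm v \<le> 2 * (1 - \<rho> (\<omega> 0) - \<rho> (\<tau> 0)) * norm v"
        using \<kappa>_le[OF ne] by (intro mult_right_mono) auto
      also have "\<dots> \<le> norm ((P p \<omega> - P p \<tau>) - (P q \<omega> - P q \<tau>))"
        using pq v ne by (intro transversality) (auto simp: E_def)
      also have "\<dots> \<le> norm (P p \<omega> - P p \<tau>) + norm (P q \<omega> - P q \<tau>)"
        by (rule norm_triangle_ineq4)
      also have "\<dots> < 2 * s" using pq unfolding E_def by (simp add: dist_norm)
      finally show "norm v < 2 * s / \<kappa>" using \<kappa> by (simp add: field_simps)
    qed simp
    also have "\<dots> = V * (2 / \<kappa>) ^ DIM('a) * s ^ DIM('a)"
      by (simp add: power_mult_distrib power_divide)
    also have "\<dots> \<le> C * s ^ DIM('a)"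
      unfolding C_def using s V by (intro mult_right_mono) (auto intro!: mult_left_mono add_increasing2)
    finally have "measure lebesgue E \<le> C * s ^ DIM('a)" .
    moreover have "measure lebesgue E \<le> V"
      unfolding V_def using E by (intro measure_mono_fmeasurable) (auto simp: subset_iff)
    moreover have "V * 1 \<le> V * max 1 ((2 / \<kappa>) ^ DIM('a))" using V by (intro mult_left_mono) auto
    ultimately show ?thesis unfolding E_def[symmetric] by (auto simp: min_def C_def)
  qed
  moreover have "0 < C" unfolding C_def using V by (simp add: add_nonneg_pos)
  ultimately show ?thesis by blast
qed

section \<open>Lower bounds for distances of images\<close>

text \<open>The mean value estimate below runs through points outside \<open>S\<close>, so uniform
  continuity is taken on the closed \<epsilon>-neighbourhood \<open>K\<close> of \<open>S\<close>,
  which is compact and inside \<open>U\<close>.\<close>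

lemma deriv_unif_continuous:
  assumes "0 < e"
  shows "\<exists>\<theta>>0. \<forall>i. \<forall>x\<in>S. \<forall>y. dist x y < \<theta> \<longrightarrow> y \<in> U \<and> norm (f' i y - f' i x) < e"
proof -
  define K where "K = {x + y |x y. x \<in> S \<and> y \<in> cball 0 \<epsilon>}"
  have K: "compact K" unfolding K_def by (intro compact_sums compact_S compact_cball)
  have KI: "y \<in> K" if "x \<in> S" "dist x y \<le> \<epsilon>" for x y
    unfolding K_def mem_Collect_eq using that
    by (intro exI[of _ x] exI[of _ "y - x"]) (simp add: dist_norm norm_minus_commute)
  have "K \<subseteq> U"
  proof
    fix k assume "k \<in> K"
    then obtain x y where "k = x + y" "x \<in> S" "norm y \<le> \<epsilon>" unfolding K_def by auto
    then show "k \<in> U" using collar[of x] by (auto simp: dist_norm subset_iff)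
  qed
  have "\<exists>\<theta>>0. \<forall>x\<in>K. \<forall>y\<in>K. dist y x < \<theta> \<longrightarrow> dist (f' i y) (f' i x) < e" for i
    using compact_uniformly_continuous[OF continuous_on_subset[OF cont_deriv \<open>K \<subseteq> U\<close>] K, of i] assms
    unfolding uniformly_continuous_on_def by blast
  then obtain \<theta> where \<theta>: "\<And>i. \<theta> i > 0" "\<And>i x y. x \<in> K \<Longrightarrow> y \<in> K \<Longrightarrow> dist y x < \<theta> i \<Longrightarrow> dist (f' i y) (f' i x) < e"
    by metis
  show ?thesis
  proof (intro exI[of _ "min \<epsilon> (Min (range \<theta>))"] conjI allI ballI impI)
    show "0 < min \<epsilon> (Min (range \<theta>))" using \<theta>(1) eps_pos by simp
    fix i x y assume *: "x \<in> S" "dist x y < min \<epsilon> (Min (range \<theta>))"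
    then have "y \<in> K" "x \<in> K" using KI eps_pos by auto
    moreover have "dist y x < \<theta> i" using * by (simp add: dist_commute)
    ultimately show "y \<in> U" "norm (f' i y - f' i x) < e"
      using \<theta>(2) \<open>K \<subseteq> U\<close> by (auto simp: dist_norm)
  qed
qed

lemma deriv_lower_bound: "\<exists>m>0. \<forall>i. \<forall>x\<in>S. m \<le> norm (f' i x)"
proof -
  have "\<exists>x\<in>S. \<forall>y\<in>S. norm (f' i x) \<le> norm (f' i y)" for i
    using z_in_S S_subset_U
    by (intro continuous_attains_inf[OF compact_S] continuous_on_norm continuous_on_subset[OF cont_deriv]) auto
  then obtain \<xi> where \<xi>: "\<And>i. \<xi> i \<in> S" "\<And>i y. y \<in> S \<Longrightarrow> norm (f' i (\<xi> i)) \<le> norm (f' i y)"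
    by metis
  show ?thesis
  proof (intro exI[of _ "Min (range (\<lambda>i. norm (f' i (\<xi> i))))"] conjI allI ballI)
    show "0 < Min (range (\<lambda>i. norm (f' i (\<xi> i))))"
      using deriv_pos[OF S_subset_U[OF \<xi>(1)]] by auto
    fix i x assume "x \<in> S"
    then show "Min (range (\<lambda>i. norm (f' i (\<xi> i)))) \<le> norm (f' i x)"
      by (intro order_trans[OF Min_le \<xi>(2)]) auto
  qed
qed

text \<open>On a ball around \<open>w\<close>, which is convex, \<open>f i\<close> differs from the
  linear map \<open>f' i w\<close> by a function with small Lipschitz constant, and by conformality
  the linear map scales distances by exactly \<open>norm (f' i w)\<close>.\<close>

lemma local_expansion:
  assumes "0 < \<eta>"
  shows "\<exists>\<theta>>0. \<forall>i. \<forall>x\<in>S. \<forall>y\<in>S. \<forall>w\<in>S. dist x y < \<theta> \<longrightarrow> dist x w < \<theta> \<longrightarrow>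
    exp (- \<eta>) * norm (f' i w) * dist x y \<le> dist (f i x) (f i y)"
proof -
  obtain m where m: "0 < m" "\<And>i x. x \<in> S \<Longrightarrow> m \<le> norm (f' i x)"
    using deriv_lower_bound by blast
  \<comment> \<open>Chosen so that subtracting \<open>e\<close> from any number that is at least
    \<open>m\<close> costs at most the factor \<open>exp (- \<eta>)\<close>.\<close>
  define e where "e = m * (1 - exp (- \<eta>))"
  have e: "0 < e" unfolding e_def using m assms by simp
  obtain \<theta> where \<theta>: "0 < \<theta>" "\<And>i x y. x \<in> S \<Longrightarrow> dist x y < \<theta> \<Longrightarrow> y \<in> U \<and> norm (f' i y - f' i x) < e"
    using deriv_unif_continuous[OF e] by blast
  have "exp (- \<eta>) * norm (f' i w) * dist x y \<le> dist (f i x) (f i y)"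
    if S: "x \<in> S" "y \<in> S" "w \<in> S" and d: "dist x y < \<theta> / 2" "dist x w < \<theta> / 2" for i x y w
  proof -
    define g where "g = (\<lambda>\<xi>. f i \<xi> - f' i w \<xi>)"
    have "norm (g x - g y) \<le> e * norm (x - y)"
    proof (rule differentiable_bound[of "ball w \<theta>" _ "\<lambda>\<xi> v. (f' i \<xi> - f' i w) v"])
      fix \<xi> assume "\<xi> \<in> ball w \<theta>"
      then have \<xi>: "\<xi> \<in> U" "norm (f' i \<xi> - f' i w) < e" using \<theta>(2)[OF S(3), of \<xi> i] by auto
      have "(g has_derivative (\<lambda>v. f' i \<xi> v - f' i w v)) (at \<xi>)"
        unfolding g_def
        by (intro has_derivative_diff deriv \<xi>(1) bounded_linear_imp_has_derivative blinfun.bounded_linear_right)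
      then show "(g has_derivative (\<lambda>v. (f' i \<xi> - f' i w) v)) (at \<xi> within ball w \<theta>)"
        by (simp add: has_derivative_at_withinI blinfun.diff_left)
      show "onorm (\<lambda>v. (f' i \<xi> - f' i w) v) \<le> e"
        using \<xi>(2) by (simp add: norm_blinfun.rep_eq)
    next
      show "x \<in> ball w \<theta>" using d(2) zero_le_dist[of x w] dist_commute[of x w] unfolding mem_ball by linarith
      show "y \<in> ball w \<theta>" using d dist_triangle3[of w y x] by simp
    qed simp
    moreover have "f' i w (x - y) = (f i x - f i y) - (g x - g y)"
      by (simp add: g_def blinfun.diff_right)
    ultimately have "norm (f' i w (x - y)) \<le> norm (f i x - f i y) + e * norm (x - y)"
      using norm_triangle_ineq4[of "f i x - f i y" "g x - g y"] by simp
    then have "(norm (f' i w) - e) * norm (x - y) \<le> norm (f i x - f i y)"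
      using conformal_linear_norm(1)[OF conformal[OF S_subset_U[OF S(3)]]] by (simp add: algebra_simps)
    moreover have "exp (- \<eta>) * norm (f' i w) \<le> norm (f' i w) - e"
    proof -
      have "e \<le> norm (f' i w) * (1 - exp (- \<eta>))"
        unfolding e_def using m(2)[OF S(3)] assms by (intro mult_right_mono) auto
      then show ?thesis by (simp add: algebra_simps)
    qed
    then have "exp (- \<eta>) * norm (f' i w) * norm (x - y) \<le> (norm (f' i w) - e) * norm (x - y)"
      by (intro mult_right_mono) auto
    ultimately show ?thesis by (simp add: dist_norm)
  qed
  \<comment> \<open>Half of \<theta>, since \<open>y\<close> is reached from \<open>w\<close>
    through \<open>x\<close>.\<close>
  then show ?thesis using \<theta>(1) by (intro exI[of _ "\<theta> / 2"]) auto
qed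

text \<open>Pairs closer than \<theta> are covered by \<open>local_expansion\<close>. The remaining
  pairs form a compact set on which injectivity keeps the images a distance \<open>c\<close> apart,
  and their own distance is at most \<open>D\<close>.\<close>

lemma f_dist_lower_bound: "\<exists>c>0. \<forall>x\<in>S. \<forall>y\<in>S. c * dist x y \<le> dist (f i x) (f i y)"
proof -
  obtain m where m: "0 < m" "\<And>i x. x \<in> S \<Longrightarrow> m \<le> norm (f' i x)"
    using deriv_lower_bound by blast
  obtain \<theta> where \<theta>: "0 < \<theta>" "\<And>x y. x \<in> S \<Longrightarrow> y \<in> S \<Longrightarrow> dist x y < \<theta> \<Longrightarrow>
      exp (- 1) * norm (f' i x) * dist x y \<le> dist (f i x) (f i y)"
    using local_expansion[of 1] by (metis dist_self less_numeral_extra(1))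
  obtain D where D: "0 < D" "\<And>x y. x \<in> S \<Longrightarrow> y \<in> S \<Longrightarrow> dist x y \<le> D"
    using diameter_bounded_bound[OF compact_imp_bounded[OF compact_S]]
    by (metis add.commute add_strict_increasing dual_order.trans less_add_one linorder_not_le order_less_imp_le zero_le_one zero_less_one)
  define Q where "Q = (S \<times> S) \<inter> (\<lambda>p. dist (fst p) (snd p)) -` {\<theta>..}"
  have "compact Q" unfolding Q_def
    by (intro compact_Int_closed compact_Times compact_S closed_vimage closed_atLeast continuous_intros)
  have c1: "\<exists>c>0. \<forall>p\<in>Q. c \<le> dist (f i (fst p)) (f i (snd p))"
  proof (cases "Q = {}")
    case False
    have cf: "continuous_on S (f i)"
      using deriv S_subset_U by (meson continuous_at_imp_continuous_on has_derivative_continuous)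
    have "continuous_on Q (\<lambda>p. dist (f i (fst p)) (f i (snd p)))"
      by (intro continuous_on_dist continuous_on_compose2[OF cf] continuous_intros) (auto simp: Q_def)
    then obtain p where p: "p \<in> Q" "\<And>q. q \<in> Q \<Longrightarrow>
        dist (f i (fst p)) (f i (snd p)) \<le> dist (f i (fst q)) (f i (snd q))"
      using continuous_attains_inf[OF \<open>compact Q\<close> False] by blast
    have "f i (fst p) \<noteq> f i (snd p)"
      using p(1) \<theta>(1) inj_onD[OF inj[of i]] S_subset_U by (fastforce simp: Q_def)
    then show ?thesis using p by (intro exI[of _ "dist (f i (fst p)) (f i (snd p))"]) auto
  qed (auto intro: exI[of _ 1])
  then obtain c where "0 < c" and Q: "\<forall>p\<in>Q. c \<le> dist (f i (fst p)) (f i (snd p))" by blast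
  have c: "c \<le> dist (f i x) (f i y)" if "x \<in> S" "y \<in> S" "\<theta> \<le> dist x y" for x y
    using Q[rule_format, of "(x, y)"] that by (simp add: Q_def)
  have "min (exp (-1) * m) (c / D) * dist x y \<le> dist (f i x) (f i y)" if "x \<in> S" "y \<in> S" for x y
  proof (cases "dist x y < \<theta>")
    case True
    have "min (exp (-1) * m) (c / D) * dist x y \<le> exp (-1) * norm (f' i x) * dist x y"
      using m(2)[OF that(1), of i] by (intro mult_right_mono) (auto intro: min.coboundedI1)
    then show ?thesis using \<theta>(2)[OF that True] by linarith
  next
    case False
    have "min (exp (-1) * m) (c / D) * dist x y \<le> c / D * D"
      using D \<open>0 < c\<close> that by (intro mult_mono) auto
    then show ?thesis using c[OF that] False D by simp
  qed
  then show ?thesis using m \<open>0 < c\<close> D by (intro exI[of _ "min (exp (-1) * m) (c / D)"]) auto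
qed

text \<open>Same shape as \<open>local_expansion\<close>, at a crude rate but without closeness. The
  factor \<open>norm (f' i w)\<close> can be inserted because it is at most 1.\<close>

lemma global_expansion:
  "\<exists>B>0. \<forall>i. \<forall>x\<in>S. \<forall>y\<in>S. \<forall>w\<in>S. exp (- B) * norm (f' i w) * dist x y \<le> dist (f i x) (f i y)"
proof -
  obtain c where c: "\<And>i. 0 < c i" "\<And>i x y. x \<in> S \<Longrightarrow> y \<in> S \<Longrightarrow> c i * dist x y \<le> dist (f i x) (f i y)"
    using f_dist_lower_bound by metis
  define c0 where "c0 = Min (range c)"
  have c0: "0 < c0" "\<And>i. c0 \<le> c i" using c(1) by (auto simp: c0_def)
  define B where "B = max 1 (- ln c0)"
  have "exp (- B) \<le> exp (ln c0)" unfolding B_def by simp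
  then have B: "exp (- B) \<le> c0" using c0 by simp
  have "exp (- B) * norm (f' i w) * dist x y \<le> dist (f i x) (f i y)" if "x \<in> S" "y \<in> S" "w \<in> S" for i x y w
  proof -
    have "norm (f' i w) \<le> 1"
      using deriv_le[OF S_subset_U[OF that(3)], of i] rho_less_1[of i] by linarith
    then have "exp (- B) * norm (f' i w) \<le> c i * 1"
      using B c0(2)[of i] c0(1) by (intro mult_mono) auto
    then have "exp (- B) * norm (f' i w) * dist x y \<le> c i * dist x y"
      by (intro mult_right_mono) auto
    then show ?thesis using c(2)[OF that(1,2), of i] by linarith
  qed
  moreover have "0 < B" by (simp add: B_def)
  ultimately show ?thesis by blast
qed

section \<open>Derivatives of word maps, \<open>Zfun\<close>, and expansion along words\<close>

text \<open>By the chain rule this is the similarity ratio of the derivative of \<open>W t u\<close>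
  at \<open>x\<close>. The product form allows a comparison letter by letter with another
  parameter.\<close>

primrec conformal_factor :: "'a ^ 'l \<Rightarrow> 'l list \<Rightarrow> 'a \<Rightarrow> real" where
  "conformal_factor t [] x = 1"
| "conformal_factor t (a # u) x = norm (f' a (W t u x)) * conformal_factor t u x"

lemma conformal_factor_pos:
  assumes "norm t < r0" "x \<in> S"
  shows "0 < conformal_factor t u x"
  by (induction u) (use deriv_pos S_subset_U W_in_S[OF assms] in auto)

lemma W_derivative:
  assumes "norm t < r0" "x \<in> S"
  shows "\<exists>D. (W t u has_derivative D) (at x) \<and> (\<forall>v. norm (D v) = conformal_factor t u x * norm v)"
proof (induction u)
  case Nil
  show ?case by (intro exI[of _ "\<lambda>v. v"]) (simp add: id_def)
next
  case (Cons a u)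
  then obtain D where D: "(W t u has_derivative D) (at x)" "\<And>v. norm (D v) = conformal_factor t u x * norm v"
    by blast
  have U: "W t u x \<in> U" using S_subset_U W_in_S assms by blast
  have tr: "transl f t a = (\<lambda>x. f a x + t $ a)" by (simp add: transl_def fun_eq_iff)
  have "(transl f t a has_derivative blinfun_apply (f' a (W t u x))) (at (W t u x))"
    unfolding tr using has_derivative_add_const[OF deriv[OF U]] .
  then have "(transl f t a \<circ> W t u has_derivative blinfun_apply (f' a (W t u x)) \<circ> D) (at x)"
    by (rule diff_chain_at[OF D(1)])
  moreover have "norm ((blinfun_apply (f' a (W t u x)) \<circ> D) v) = conformal_factor t (a # u) x * norm v" for v
    using D(2) conformal_linear_norm(1)[OF conformal[OF U]] by simp
  ultimately show ?case unfolding word_comp.simps by blast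
qed

lemma sv_fun_W:
  assumes "norm t < r0" "x \<in> S" "k \<le> DIM('a)"
  shows "sv_fun (frechet_derivative (W t u) (at x)) k = conformal_factor t u x ^ k"
proof -
  obtain D where "(W t u has_derivative D) (at x)" "\<And>v. norm (D v) = conformal_factor t u x * norm v"
    using W_derivative[OF assms(1,2)] by blast
  then show ?thesis using sv_fun_conformal[OF _ assms(3)] frechet_derivative_at by metis
qed

text \<open>Among the powers of \<open>s / \<alpha>\<close> the smallest is the one with exponent 0
  or \<open>DIM('a)\<close>, according to whether the ratio is above or below 1. Coded points lie in
  \<open>S\<close>.\<close>

lemma Zfun_ge:
  assumes t: "norm t < r0" and s: "0 < s"
    and le: "\<And>x. x \<in> S \<Longrightarrow> b \<le> min 1 ((s / conformal_factor t u x) ^ DIM('a))"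
  shows "b \<le> Zfun (transl f t) z u s"
  unfolding Zfun_def
proof (rule cINF_greatest)
  fix \<sigma> :: "nat \<Rightarrow> 'l"
  define \<alpha> where "\<alpha> = conformal_factor t u (P t \<sigma>)"
  have \<alpha>: "0 < s / \<alpha>" unfolding \<alpha>_def using s conformal_factor_pos[OF t P_in_S[OF t]] by simp
  have "b \<le> s ^ k / sv_fun (frechet_derivative (W t u) (at (P t \<sigma>))) k" if k: "k \<le> DIM('a)" for k
  proof -
    have "b \<le> min 1 ((s / \<alpha>) ^ DIM('a))" unfolding \<alpha>_def by (rule le[OF P_in_S[OF t]])
    also have "\<dots> \<le> (s / \<alpha>) ^ k"
    proof (cases "s / \<alpha> \<le> 1")
      case True
      then show ?thesis using power_decreasing[OF k, of "s / \<alpha>"] \<alpha> by (simp add: min.coboundedI2)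
    next
      case False
      then show ?thesis using one_le_power[of "s / \<alpha>" k] by (simp add: min.coboundedI1)
    qed
    also have "\<dots> = s ^ k / sv_fun (frechet_derivative (W t u) (at (P t \<sigma>))) k"
      unfolding sv_fun_W[OF t P_in_S[OF t] k] \<alpha>_def by (rule power_divide)
    finally show ?thesis .
  qed
  then show "b \<le> Min ((\<lambda>k. s ^ k / sv_fun (frechet_derivative (W t u) (at (P t \<sigma>))) k) ` {0..DIM('a)})"
    by simp
qed simp

text \<open>The first \<open>N\<close> letters to act cost a factor \<open>exp (- B)\<close> each; afterwards all points involved are
  so close together that a letter costs only \<open>exp (- \<eta>)\<close>.\<close>

lemma W_expansion:
  fixes B \<eta> a K :: real
  assumes B: "\<And>i x y w. x \<in> S \<Longrightarrow> y \<in> S \<Longrightarrow> w \<in> S \<Longrightarrow>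
      exp (- B) * norm (f' i w) * dist x y \<le> dist (f i x) (f i y)" "0 \<le> B"
    and \<eta>: "\<And>i x y w. x \<in> S \<Longrightarrow> y \<in> S \<Longrightarrow> w \<in> S \<Longrightarrow> dist x y < 2 * a \<Longrightarrow> dist x w < 2 * a \<Longrightarrow>
      exp (- \<eta>) * norm (f' i w) * dist x y \<le> dist (f i x) (f i y)" "0 \<le> \<eta>"
    and K: "\<And>t u x y. norm t < r0 \<Longrightarrow> x \<in> S \<Longrightarrow> y \<in> S \<Longrightarrow> dist (W t u x) (W t u y) \<le> K * r ^ length u"
    and N: "0 < K" "K * r ^ N < a"
    and t: "norm t < r0" "norm t0 < r0" "dist t t0 / (1 - r) \<le> a" "a \<le> \<epsilon>"
    and S: "x \<in> S" "y \<in> S" "w \<in> S"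
  shows "exp (- (N * B + length u * \<eta>)) * conformal_factor t0 u w * dist x y \<le> dist (W t u x) (W t u y)"
proof -
  \<comment> \<open>The minimum counts the expensive letters met so far, which makes the claim
    inductive; it is weakened to \<open>N\<close> at the end.\<close>
  have "exp (- (min (length u) N * B + length u * \<eta>)) * conformal_factor t0 u w * dist x y
      \<le> dist (W t u x) (W t u y)"
  proof (induction u)
    case (Cons b u)
    define n where "n = length u"
    define X Y V where "X = W t u x" and "Y = W t u y" and "V = W t0 u w"
    have XYV: "X \<in> S" "Y \<in> S" "V \<in> S" using W_in_S t S by (auto simp: X_def Y_def V_def)
    \<comment> \<open>The increment of the exponent: \<open>B + \<eta>\<close> for the first
      \<open>N\<close> letters, \<eta> afterwards.\<close>
    define c where "c = min (Suc n) N * B + Suc n * \<eta> - (min n N * B + n * \<eta>)"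
    have step: "exp (- c) * norm (f' b V) * dist X Y \<le> dist (f b X) (f b Y)"
    proof (cases "n < N")
      case True
      then have "c = B + \<eta>" by (simp add: c_def min_def algebra_simps)
      then have "exp (- c) * norm (f' b V) * dist X Y \<le> exp (- B) * norm (f' b V) * dist X Y"
        using \<eta>(2) by (intro mult_right_mono) auto
      then show ?thesis using B(1)[OF XYV] by (rule order_trans)
    next
      case False
      then have c: "c = \<eta>" by (simp add: c_def min_def algebra_simps)
      have "K * r ^ n \<le> K * r ^ N"
        using False r_pos r_less_1 N(1) by (intro mult_left_mono power_decreasing) auto
      then have Kn: "K * r ^ n < a" using N(2) by linarith
      have "0 \<le> a" using t(3) r_less_1 by (meson diff_gt_0_iff_gt divide_nonneg_pos order_trans zero_le_dist)
      have "dist X Y < 2 * a" using K[OF t(1) S(1,2), of u] Kn \<open>0 \<le> a\<close> by (simp add: X_def Y_def n_def)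
      \<comment> \<open>\<open>X\<close> and \<open>V\<close> differ in both the point and the
        parameter. Passing through \<open>W t u w\<close> separates the two changes; each costs at
        most \<open>a\<close>, hence the \<open>2 * a\<close>.\<close>
      moreover have "dist X V < 2 * a"
      proof -
        have "dist (W t u w) V \<le> dist t t0 / (1 - r)"
          unfolding V_def using t S r_less_1 norm_diff_nth_le by (intro W_dist_param_le) auto
        then show ?thesis
          using K[OF t(1) S(1,3), of u] Kn t(3) dist_triangle[of X V "W t u w"] by (simp add: X_def n_def)
      qed
      ultimately show ?thesis unfolding c using \<eta>(1)[OF XYV] by blast
    qed
    have "exp (- (min (length (b # u)) N * B + length (b # u) * \<eta>)) * conformal_factor t0 (b # u) w * dist x y
        = exp (- c) * norm (f' b V) * (exp (- (min n N * B + n * \<eta>)) * conformal_factor t0 u w * dist x y)"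
    proof -
      have "exp (- (min (Suc n) N * B + Suc n * \<eta>)) = exp (- c) * exp (- (min n N * B + n * \<eta>))"
        unfolding c_def exp_add[symmetric] by simp
      then show ?thesis by (simp add: n_def V_def del: of_nat_Suc)
    qed
    also have "\<dots> \<le> exp (- c) * norm (f' b V) * dist X Y"
      using Cons unfolding n_def X_def Y_def by (intro mult_left_mono) auto
    also note step
    finally show ?case by (simp add: X_def Y_def)
  qed simp
  moreover have "exp (- (N * B + length u * \<eta>)) * conformal_factor t0 u w * dist x y
      \<le> exp (- (min (length u) N * B + length u * \<eta>)) * conformal_factor t0 u w * dist x y"
    using B(2) conformal_factor_pos[OF t(2) S(3), of u]
    by (intro mult_right_mono) (auto intro!: mult_right_mono)
  ultimately show ?thesis by linarith
qed

section \<open>The rate, and the generalized transversality condition\<close>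

text \<open>\<open>local_expansion\<close> makes the rate vanish, \<open>global_expansion\<close>
  bounds it. The distance is the \<open>2 * a\<close> of \<open>W_expansion\<close> for
  \<open>a = \<delta> / (1 - r)\<close>, the displacement caused by moving the parameter by
  \<delta>.\<close>

lemma expansion_rate:
  "\<exists>\<psi>. (\<forall>\<delta>>0. 0 \<le> \<psi> \<delta> \<and> (\<forall>i. \<forall>x\<in>S. \<forall>y\<in>S. \<forall>w\<in>S. dist x y < 2 * (\<delta> / (1 - r)) \<longrightarrow> dist x w < 2 * (\<delta> / (1 - r)) \<longrightarrow>
      exp (- \<psi> \<delta>) * norm (f' i w) * dist x y \<le> dist (f i x) (f i y))) \<and> (\<psi> \<longlongrightarrow> 0) (at_right 0)"
proof -
  obtain B where B: "0 < B" "\<And>i x y w. x \<in> S \<Longrightarrow> y \<in> S \<Longrightarrow> w \<in> S \<Longrightarrow>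
      exp (- B) * norm (f' i w) * dist x y \<le> dist (f i x) (f i y)"
    using global_expansion by blast
  show ?thesis
  proof (rule exists_vanishing_rate[OF _ _ B(1)])
    fix \<delta> \<eta> \<eta>' :: real
    assume Q: "\<forall>i. \<forall>x\<in>S. \<forall>y\<in>S. \<forall>w\<in>S. dist x y < 2 * (\<delta> / (1 - r)) \<longrightarrow> dist x w < 2 * (\<delta> / (1 - r)) \<longrightarrow>
      exp (- \<eta>) * norm (f' i w) * dist x y \<le> dist (f i x) (f i y)" and le: "\<eta> \<le> \<eta>'"
    have "exp (- \<eta>') * norm (f' i w) * dist x y \<le> exp (- \<eta>) * norm (f' i w) * dist x y" for i w x y
      using le by (intro mult_right_mono) auto
    then show "\<forall>i. \<forall>x\<in>S. \<forall>y\<in>S. \<forall>w\<in>S. dist x y < 2 * (\<delta> / (1 - r)) \<longrightarrow> dist x w < 2 * (\<delta> / (1 - r)) \<longrightarrow>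
      exp (- \<eta>') * norm (f' i w) * dist x y \<le> dist (f i x) (f i y)"
      using Q order_trans by meson
  next
    fix \<eta> :: real
    assume "0 < \<eta>"
    obtain \<theta> where "0 < \<theta>" and \<theta>: "\<forall>i. \<forall>x\<in>S. \<forall>y\<in>S. \<forall>w\<in>S. dist x y < \<theta> \<longrightarrow> dist x w < \<theta> \<longrightarrow>
        exp (- \<eta>) * norm (f' i w) * dist x y \<le> dist (f i x) (f i y)"
      using local_expansion[OF \<open>0 < \<eta>\<close>] by (elim exE conjE) (rule that)
    have less: "c < \<theta>" if "\<delta> < \<theta> * (1 - r) / 2" "c < 2 * (\<delta> / (1 - r))" for \<delta> c
    proof -
      have "2 * (\<delta> / (1 - r)) < \<theta>" using that r_less_1 by (simp add: pos_divide_less_eq algebra_simps)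
      then show ?thesis using that by linarith
    qed
    show "\<exists>\<theta>>0. \<forall>\<delta><\<theta>. \<forall>i. \<forall>x\<in>S. \<forall>y\<in>S. \<forall>w\<in>S. dist x y < 2 * (\<delta> / (1 - r)) \<longrightarrow>
        dist x w < 2 * (\<delta> / (1 - r)) \<longrightarrow> exp (- \<eta>) * norm (f' i w) * dist x y \<le> dist (f i x) (f i y)"
    proof (intro exI[of _ "\<theta> * (1 - r) / 2"] conjI allI ballI impI)
      show "0 < \<theta> * (1 - r) / 2" using \<open>0 < \<theta>\<close> r_less_1 by simp
    qed (rule \<theta>[rule_format]; (assumption | erule (1) less))
  qed (use B(2) in blast)
qed

lemma GTC_transl: "GTC (transl f) z (ball 0 r0) lebesgue"
proof -
  let ?d = "DIM('a)"
  obtain K where K: "0 < K" "\<And>t u x y. norm t < r0 \<Longrightarrow> x \<in> S \<Longrightarrow> y \<in> S \<Longrightarrow>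
      dist (W t u x) (W t u y) \<le> K * r ^ length u"
    using W_dist_le by blast
  obtain B where B: "0 < B" "\<And>i x y w. x \<in> S \<Longrightarrow> y \<in> S \<Longrightarrow> w \<in> S \<Longrightarrow>
      exp (- B) * norm (f' i w) * dist x y \<le> dist (f i x) (f i y)"
    using global_expansion by blast
  obtain \<psi> where \<psi>: "\<And>\<delta>. 0 < \<delta> \<Longrightarrow> 0 \<le> \<psi> \<delta>"
      "\<And>\<delta> i x y w. 0 < \<delta> \<Longrightarrow> x \<in> S \<Longrightarrow> y \<in> S \<Longrightarrow> w \<in> S \<Longrightarrow> dist x y < 2 * (\<delta> / (1 - r)) \<Longrightarrow>
        dist x w < 2 * (\<delta> / (1 - r)) \<Longrightarrow> exp (- \<psi> \<delta>) * norm (f' i w) * dist x y \<le> dist (f i x) (f i y)"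
      "(\<psi> \<longlongrightarrow> 0) (at_right 0)"
    using expansion_rate by blast
  obtain M where M: "0 < M" "\<And>t0 \<delta> \<omega> \<tau> s. 0 < s \<Longrightarrow> 0 < \<delta> \<Longrightarrow> \<delta> \<le> \<epsilon> * (1 - r) / 2 \<Longrightarrow> \<omega> 0 \<noteq> \<tau> 0 \<Longrightarrow>
      measure lebesgue {t \<in> ball t0 \<delta> \<inter> ball 0 r0. dist (P t \<omega>) (P t \<tau>) < s} \<le> M * min 1 (s ^ ?d)"
    using measure_P_close_le by blast
  \<comment> \<open>Within the range of \<open>measure_P_close_le\<close>, and small enough that
    parameters within \<delta> displace points by at most \<epsilon>.\<close>
  define \<delta>0 where "\<delta>0 = \<epsilon> * (1 - r) / 2"
  have \<delta>0: "0 < \<delta>0" using eps_pos r_less_1 by (simp add: \<delta>0_def)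
  have small: "\<delta> / (1 - r) \<le> \<epsilon>" if "\<delta> < \<delta>0" "0 < \<delta>" for \<delta>
  proof -
    have "\<delta> < \<epsilon> * (1 - r)" using that unfolding \<delta>0_def by linarith
    then show ?thesis using r_less_1 by (simp add: pos_divide_le_eq)
  qed
  have main: "\<exists>C>0. \<forall>\<omega> \<tau>. \<omega> \<noteq> \<tau> \<longrightarrow> (\<forall>s>0.
      {t \<in> ball t0 \<delta> \<inter> ball 0 r0. dist (P t \<omega>) (P t \<tau>) < s} \<in> sets lebesgue \<and>
      emeasure lebesgue {t \<in> ball t0 \<delta> \<inter> ball 0 r0. dist (P t \<omega>) (P t \<tau>) < s}
        \<le> ennreal (C * exp (real (cpl \<omega> \<tau>) * (?d * \<psi> \<delta>)) * Zfun (transl f t0) z (restr \<omega> (cpl \<omega> \<tau>)) s))"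
    if t0: "t0 \<in> ball 0 r0" and \<delta>: "0 < \<delta>" "\<delta> < \<delta>0" for t0 \<delta>
  proof -
    have "(\<lambda>n. K * r ^ n) \<longlonglongrightarrow> K * 0"
      using r_pos r_less_1 by (intro tendsto_mult_left LIMSEQ_power_zero) auto
    then have "\<forall>\<^sub>F n in sequentially. K * r ^ n < \<delta> / (1 - r)"
      by (rule order_tendstoD) (use \<delta> r_less_1 in simp)
    then obtain N where N: "K * r ^ N < \<delta> / (1 - r)" by (auto simp: eventually_sequentially)
    \<comment> \<open>Independent of the codes and of \<open>s\<close>, since \<open>N\<close> was
      fixed from \<delta> beforehand. The power arises because a loss in distance enters the measure
      bound to the power \<open>?d\<close>; for the same reason the final rate is
      \<open>?d * \<psi> \<delta>\<close>.\<close>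
    define C where "C = M * exp (N * B) ^ ?d"
    have le: "emeasure lebesgue {t \<in> ball t0 \<delta> \<inter> ball 0 r0. dist (P t \<omega>) (P t \<tau>) < s}
        \<le> ennreal (C * exp (real (cpl \<omega> \<tau>) * (?d * \<psi> \<delta>)) * Zfun (transl f t0) z (restr \<omega> (cpl \<omega> \<tau>)) s)"
      if ne: "\<omega> \<noteq> \<tau>" and s: "0 < s" for \<omega> \<tau> s
    proof -
      define n where "n = cpl \<omega> \<tau>"
      define u where "u = restr \<omega> n"
      define \<omega>' \<tau>' where "\<omega>' = (\<lambda>m. \<omega> (n + m))" and "\<tau>' = (\<lambda>m. \<tau> (n + m))"
      define E where "E = {t \<in> ball t0 \<delta> \<inter> ball 0 r0. dist (P t \<omega>) (P t \<tau>) < s}"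
      \<comment> \<open>The total loss of \<open>W_expansion\<close> along the common
        prefix.\<close>
      define e where "e = exp (N * B + n * \<psi> \<delta>)"
      have "\<exists>m. \<omega> m \<noteq> \<tau> m" using ne by auto
      then have "\<omega> n \<noteq> \<tau> n" unfolding n_def cpl_def by (rule LeastI_ex)
      then have ne': "\<omega>' 0 \<noteq> \<tau>' 0" by (simp add: \<omega>'_def \<tau>'_def)
      have u: "u = restr \<tau> n"
        unfolding u_def restr_def n_def cpl_def by (auto dest: not_less_Least)
      have len: "length u = n" by (simp add: u_def)
      have e1: "1 \<le> e" unfolding e_def using B(1) \<psi>(1)[OF \<delta>(1)] by simp
      \<comment> \<open>Dividing the measure by the constants gives a number below every term of the
        infimum, as \<open>Zfun_ge\<close> requires.\<close>
      have bound: "measure lebesgue E / (M * e ^ ?d) \<le> min 1 ((s / conformal_factor t0 u x) ^ ?d)"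
        if x: "x \<in> S" for x
      proof -
        define \<alpha> where "\<alpha> = conformal_factor t0 u x"
        have \<alpha>: "0 < \<alpha>" unfolding \<alpha>_def using conformal_factor_pos[OF _ x] t0 by simp
        have sub: "E \<subseteq> {t \<in> ball t0 \<delta> \<inter> ball 0 r0. dist (P t \<omega>') (P t \<tau>') < e * (s / \<alpha>)}"
        proof (clarsimp simp: E_def)
          fix t assume t: "dist t0 t < \<delta>" "norm t < r0" "dist (P t \<omega>) (P t \<tau>) < s"
          have "exp (- (N * B + length u * \<psi> \<delta>)) * \<alpha> * dist (P t \<omega>') (P t \<tau>')
              \<le> dist (W t u (P t \<omega>')) (W t u (P t \<tau>'))"
            unfolding \<alpha>_def
          proof (rule W_expansion[where a = "\<delta> / (1 - r)" and K = K])
            show "dist t t0 / (1 - r) \<le> \<delta> / (1 - r)"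
              using t(1) r_less_1 by (intro divide_right_mono) (auto simp: dist_commute)
          qed (use B \<psi>(1,2)[OF \<delta>(1)] K N t t0 small \<delta> x P_in_S in auto)
          also have "\<dots> = dist (P t \<omega>) (P t \<tau>)"
            using P_add[OF t(2), of \<omega> n] P_add[OF t(2), of \<tau> n] u by (simp add: u_def \<omega>'_def \<tau>'_def)
          also note t(3)
          finally have "inverse e * \<alpha> * dist (P t \<omega>') (P t \<tau>') < s"
            unfolding e_def len exp_minus .
          then show "dist (P t \<omega>') (P t \<tau>') < e * s / \<alpha>"
            using e1 \<alpha> by (simp add: field_simps)
        qed
        have "measure lebesgue E
            \<le> measure lebesgue {t \<in> ball t0 \<delta> \<inter> ball 0 r0. dist (P t \<omega>') (P t \<tau>') < e * (s / \<alpha>)}"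
          using open_P_close sub
          by (intro measure_mono_fmeasurable)
            (auto simp: E_def intro!: bounded_set_imp_lmeasurable intro: bounded_subset[OF bounded_ball, of _ t0 \<delta>])
        also have "\<dots> \<le> M * min 1 ((e * (s / \<alpha>)) ^ ?d)"
          using \<delta> e1 s \<alpha> ne' by (intro M(2)) (auto simp: \<delta>0_def)
        also have "\<dots> \<le> M * (e ^ ?d * min 1 ((s / \<alpha>) ^ ?d))"
          unfolding power_mult_distrib[of e]
          using M(1) e1 s \<alpha> by (intro mult_left_mono min_one_mult_le) auto
        finally have "measure lebesgue E \<le> min 1 ((s / \<alpha>) ^ ?d) * (M * e ^ ?d)"
          by (simp only: mult_ac)
        moreover have "0 < M * e ^ ?d" using M(1) e1 by simp
        ultimately show ?thesis unfolding \<alpha>_def[symmetric] by (simp only: pos_divide_le_eq)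
      qed
      have "measure lebesgue E / (M * e ^ ?d) \<le> Zfun (transl f t0) z u s"
        using t0 s bound by (intro Zfun_ge) auto
      then have "measure lebesgue E \<le> M * e ^ ?d * Zfun (transl f t0) z u s"
        using M(1) e1 by (simp add: pos_divide_le_eq mult.commute)
      also have "e ^ ?d = exp (N * B) ^ ?d * exp (n * (?d * \<psi> \<delta>))"
        unfolding e_def exp_add power_mult_distrib by (simp add: mult.commute mult.left_commute flip: exp_of_nat_mult)
      finally have le: "measure lebesgue E \<le> C * exp (n * (?d * \<psi> \<delta>)) * Zfun (transl f t0) z u s"
        by (simp add: C_def mult.assoc)
      have "E \<in> lmeasurable"
        unfolding E_def using open_P_close
        by (intro bounded_set_imp_lmeasurable) (auto intro: bounded_subset[OF bounded_ball, of _ t0 \<delta>])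
      then have "emeasure lebesgue E = ennreal (measure lebesgue E)"
        by (simp add: emeasure_eq_measure2)
      then show ?thesis
        unfolding E_def[symmetric] n_def[symmetric] u_def[symmetric]
        using ennreal_leI[OF le] by (simp only:)
    qed
    show ?thesis
    proof (intro exI[of _ C] conjI allI impI)
      show "0 < C" using M(1) by (simp add: C_def)
      show "{t \<in> ball t0 \<delta> \<inter> ball 0 r0. dist (P t \<omega>) (P t \<tau>) < s} \<in> sets lebesgue" for \<omega> \<tau> s
        by (simp only: sets_completionI_sets sets_lborel borel_open open_P_close)
    qed (rule le)
  qed
  show ?thesis
    unfolding GTC_def
  proof (rule exI[of _ \<delta>0], rule conjI, rule \<delta>0, rule exI[of _ "\<lambda>\<delta>. ?d * \<psi> \<delta>"], intro conjI ballI)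
    show "((\<lambda>\<delta>. ?d * \<psi> \<delta>) \<longlongrightarrow> 0) (at_right 0)"
      using tendsto_mult_left[OF \<psi>(3), of "real ?d"] by simp
    show "0 \<le> ?d * \<psi> \<delta>" if "\<delta> \<in> {0<..<\<delta>0}" for \<delta>
      using \<psi>(1) that by simp
  qed (rule main; simp)
qed

end

section \<open>Choice of the constants from the hypotheses\<close>

theorem theorem5p1:
  fixes f :: "'l::finite \<Rightarrow> real ^ 'd \<Rightarrow> real ^ 'd"
    and f' :: "'l \<Rightarrow> real ^ 'd \<Rightarrow> ((real ^ 'd) \<Rightarrow>\<^sub>L (real ^ 'd))"
    and S U :: "(real ^ 'd) set"
    and \<rho> :: "'l \<Rightarrow> real"
    and z :: "real ^ 'd"
  assumes S_compact: "compact S" and S_nonempty: "S \<noteq> {}"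
    and S_connected: "connected S"
    and S_regular: "S = closure (interior S)"
    and f_into: "\<And>i. f i ` S \<subseteq> interior S"
    and U_bounded: "bounded U" and U_connected: "connected U" and U_open: "open U"
    and S_sub_U: "S \<subseteq> U"
    and f_U: "\<And>i. f i ` U \<subseteq> U"
    and f_deriv: "\<And>i x. x \<in> U \<Longrightarrow> (f i has_derivative blinfun_apply (f' i x)) (at x)"
    and f_C1: "\<And>i. continuous_on U (f' i)"
    and f_inj: "\<And>i. inj_on (f i) U"
    and f_inv_C1: "\<And>i. \<exists>g. (\<forall>x\<in>U. g (f i x) = x) \<and> C1_on (f i ` U) g"
    and f_open_image: "\<And>i. open (f i ` U)"
    and f_conformal: "\<And>i x. x \<in> U \<Longrightarrow> conformal_linear (blinfun_apply (f' i x))"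
    and rho_bdd: "\<And>i. bdd_above ((\<lambda>x. norm (f' i x)) ` U)"
    and rho_def: "\<And>i. \<rho> i = (SUP x\<in>U. norm (f' i x))"
    and rho_lt1: "\<And>i. \<rho> i < 1"
    and rho_pair: "\<And>i j. i \<noteq> j \<Longrightarrow> \<rho> i + \<rho> j < 1"
    and z_in_S: "z \<in> S"
  shows "\<exists>r0>0. GTC (\<lambda>t. transl f t) z (ball 0 r0) lebesgue"
proof -
  obtain \<epsilon> where \<epsilon>: "0 < \<epsilon>" "(\<Union>x\<in>S. cball x \<epsilon>) \<subseteq> U"
    using compact_subset_open_imp_cball_epsilon_subset[OF S_compact U_open S_sub_U] by blast
  then have collar: "cball x \<epsilon> \<subseteq> U" if "x \<in> S" for x
    using that by blast
  have norm_le: "norm (f' i x) \<le> \<rho> i" if "x \<in> U" for i x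
    unfolding rho_def using that by (intro cSUP_upper rho_bdd)
  define r where "r = Max (range \<rho>)"
  have r: "\<rho> i \<le> r" "r < 1" for i
    unfolding r_def using rho_lt1 by auto
  have "continuous_on S (f i)" for i
    using f_deriv S_sub_U by (meson continuous_at_imp_continuous_on has_derivative_continuous subsetD)
  then have "compact (\<Union>i. f i ` S)"
    by (intro compact_UN compact_continuous_image S_compact) auto
  moreover have "(\<Union>i. f i ` S) \<subseteq> interior S" using f_into by blast
  \<comment> \<open>The images of \<open>S\<close> form a compact subset of the open set
    \<open>interior S\<close>; the room around them bounds the admissible translations.\<close>
  ultimately obtain r0 where r0: "0 < r0" "(\<Union>y\<in>(\<Union>i. f i ` S). cball y r0) \<subseteq> interior S"
    using compact_subset_open_imp_cball_epsilon_subset[OF _ open_interior] by blast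
  have stable: "f i x + v \<in> S" if "x \<in> S" "norm v < r0" for i x v
  proof -
    have "f i x + v \<in> cball (f i x) r0" using that by (simp add: dist_norm)
    then show ?thesis using r0(2) that(1) interior_subset by blast
  qed
  interpret translated_conformal_ifs f f' S U \<rho> z \<epsilon> r0 r
    by unfold_locales
      (fact S_compact S_connected z_in_S \<epsilon>(1) collar f_deriv f_C1 f_inj f_conformal norm_le r rho_pair
        r0(1) stable)+
  show ?thesis using GTC_transl r0(1) by blast
qed

end
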